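(* Let $X$ and $Y$ be Asplund spaces, let $P$ be a topological space, let $F\colon X\rightrightarrows Y$ be a set-valued mapping, $g\colon X\times P\to Y$ a single-valued mapping, and $\varphi\colon X\times P\to(-\infty,\infty]$ a function. Define $$\mu(p):=\inf\big\{\varphi(x,p)\ \big|\ 0\in F(x)-g(x,p)\big\},\quad p\in P.$$ Fix $\bar p\in P$ and let $\bar x$ be a solution to the problem of minimizing $\varphi(x,\bar p)$ subject to $0\in F(x)-g(x,\bar p)$. Suppose that $\varphi$ is upper semicontinuous at $(\bar x,\bar p)$ and that: - The multifunction $F$ is closed around $(\bar x,g(\bar x,\bar p))$. - There are neighborhoods $U$ of $\bar x$ and $O$ of $\bar p$ as well as a number $\ell\ge 0$ such that the mapping $g(\cdot,p)$ is Lipschitz continuous on $U$ for each $p\in O$ with the uniform modulus $\ell$, while the mapping $g(\bar x,\cdot)$ is continuous on $O$. - $\ell<\widehat\alpha\big(F,\bar x,g(\bar x,\bar p)\big)$, where $\widehat\alpha$ denotes the covering constant. Then the optimal value function $\mu(\cdot)$ is upper semicontinuous at $\bar p$. If furthermore $P$ is a metric space with the metric $\rho$, and if the cost function $\varphi$ and the mapping $g(\bar x,\cdot)$ are calm at the points $(\bar x,\bar p)$ and $\bar p$, respectively, with some moduli, then there exist $\kappa>0$ and a neighborhood of $\bar p$ such that $$\mu(p)\le\mu(\bar p)+\kappa\,\rho(p,\bar p)$$ for all $p$ in this neighborhood.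
   Context: A Banach space $Z$ is Asplund if every convex continuous function defined on an open convex subset $O$ of $Z$ is Fréchet differentiable on a dense subset of $O$. $B_Z(z,r)$ denotes the closed ball of radius $r$ centered at $z$; $\mathrm{gph}\,\Phi=\{(x,y): y\in\Phi(x)\}$. Solution: $\bar x$ solves the problem at $\bar p$ if $0\in F(\bar x)-g(\bar x,\bar p)$ and $\varphi(\bar x,\bar p)\le\varphi(x,\bar p)$ for all $x$ with $0\in F(x)-g(x,\bar p)$; then $\mu(\bar p)=\varphi(\bar x,\bar p)>-\infty$. Closed around: $F$ is closed around $(\bar x,\bar y)\in\mathrm{gph}\,F$ if there are neighborhoods $U$ of $\bar x$ and $V$ of $\bar y$ such that $\mathrm{gph}\,F\cap(\mathrm{cl}\,U\times\mathrm{cl}\,V)$ is closed in $X\times Y$. Calmness: a single-valued mapping $h$ from a metric space $(M,d)$ to a normed space is calm at $\bar m$ with modulus $\kappa\ge 0$ if $\|h(m)-h(\bar m)\|\le\kappa\,d(m,\bar m)$ for all $m$ in some neighborhood of $\bar m$. For $\varphi$ the space $X\times P$ carries the metric $\|x-x'\|+\rho(p,p')$, so calmness of $\varphi$ at $(\bar x,\bar p)$ means $|\varphi(x,p)-\varphi(\bar x,\bar p)|\le\kappa_1(\|x-\bar x\|+\rho(p,\bar p))$ for all $(x,p)$ near $(\bar x,\bar p)$ (with finite values there). Prenormal cone: for a nonempty subset $\Theta$ of a normed space $Z$ and $\bar z\in\Theta$, $\widehat N(\bar z;\Theta)=\{z^*\in Z^*:\ \limsup_{z\to\bar z,\,z\in\Theta}\langle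 z^*,z-\bar z\rangle/\|z-\bar z\|\le 0\}$. Precoderivative: for $\Phi\colon X\rightrightarrows Y$ and $(x,y)\in\mathrm{gph}\,\Phi$, $\widehat D^*\Phi(x,y)(y^* )=\{x^*\in X^*:\ (x^*,-y^* )\in\widehat N((x,y);\mathrm{gph}\,\Phi)\}$ for $y^*\in Y^*$. Covering constant: $\widehat\alpha(\Phi,\bar x,\bar y)=\sup_{\eta>0}\inf\{\|x^*\|:\ x^*\in\widehat D^*\Phi(x,y)(y^* ),\ x\in B_X(\bar x,\eta),\ y\in\Phi(x)\cap B_Y(\bar y,\eta),\ \|y^*\|=1\}$, with the usual convention $\inf\emptyset=+\infty$. *)

theory Defs
  imports "HOL-Analysis.Analysis"
begin

text \<open>\<^const>\<open>differentiable\<close> at a point is Frechet differentiability (bounded linear derivative).\<close>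

definition asplund :: "'z::banach itself \<Rightarrow> bool" where
  "asplund _ \<longleftrightarrow>
     (\<forall>(W::'z set) f::'z \<Rightarrow> real.
        open W \<and> convex W \<and> convex_on W f \<and> continuous_on W f \<longrightarrow>
        W \<subseteq> closure {z \<in> W. f differentiable (at z)})"

definition gph :: "('a \<Rightarrow> 'b set) \<Rightarrow> ('a \<times> 'b) set" where
  "gph F = {(x, y). y \<in> F x}"

text \<open>Neighborhoods here are not required to be open: \<open>U\<close> is a neighborhood of \<open>x\<close> iff
  \<open>x \<in> interior U\<close>.\<close>

definition closed_around ::
  "('x::real_normed_vector \<Rightarrow> 'y::real_normed_vector set) \<Rightarrow> 'x \<Rightarrow> 'y \<Rightarrow> bool" where
  "closed_around F x y \<longleftrightarrow>
     (x, y) \<in> gph F \<and>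
     (\<exists>U V. x \<in> interior U \<and> y \<in> interior V \<and> closed (gph F \<inter> (closure U \<times> closure V)))"

text \<open>\<^term>\<open>at z within \<Theta>\<close> excludes \<open>z\<close> itself, where the quotient is not defined. At an isolated
  point of \<open>\<Theta>\<close> the upper limit is \<open>-\<infinity>\<close> and the cone is the whole dual.\<close>

definition prenormal_cone :: "'z::real_normed_vector \<Rightarrow> 'z set \<Rightarrow> ('z \<Rightarrow>\<^sub>L real) set" where
  "prenormal_cone z \<Theta> =
     {zs. Limsup (at z within \<Theta>) (\<lambda>u. ereal (blinfun_apply zs (u - z) / norm (u - z))) \<le> 0}"

text \<open>The pair \<open>(x\<^sup>*, y\<^sup>*)\<close> as the functional \<open>(u, v) \<mapsto> \<langle>x\<^sup>*, u\<rangle> + \<langle>y\<^sup>*, v\<rangle>\<close>. The norm of the product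
  type is the Euclidean combination of the two norms; the prenormal cone does not change when a
  norm is replaced by an equivalent one.\<close>

definition dual_pair ::
  "('x::real_normed_vector \<Rightarrow>\<^sub>L real) \<Rightarrow> ('y::real_normed_vector \<Rightarrow>\<^sub>L real) \<Rightarrow> ('x \<times> 'y) \<Rightarrow>\<^sub>L real" where
  "dual_pair xs ys = (xs o\<^sub>L fst_blinfun) + (ys o\<^sub>L snd_blinfun)"

definition precoderivative ::
  "('x::real_normed_vector \<Rightarrow> 'y::real_normed_vector set) \<Rightarrow> 'x \<Rightarrow> 'y \<Rightarrow>
   ('y \<Rightarrow>\<^sub>L real) \<Rightarrow> ('x \<Rightarrow>\<^sub>L real) set" where
  "precoderivative F x y ys = {xs. dual_pair xs (- ys) \<in> prenormal_cone (x, y) (gph F)}"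

definition covering_const ::
  "('x::real_normed_vector \<Rightarrow> 'y::real_normed_vector set) \<Rightarrow> 'x \<Rightarrow> 'y \<Rightarrow> ereal" where
  "covering_const F xb yb =
     (SUP \<eta>\<in>{0<..}. Inf {ereal (norm xs) | xs x y ys.
        xs \<in> precoderivative F x y ys \<and> x \<in> cball xb \<eta> \<and> y \<in> F x \<inter> cball yb \<eta> \<and> norm ys = 1})"

definition feasible ::
  "('x \<Rightarrow> 'y::real_normed_vector set) \<Rightarrow> ('x \<times> 'p \<Rightarrow> 'y) \<Rightarrow> 'p \<Rightarrow> 'x set" where
  "feasible F g p = {x. 0 \<in> {y - g (x, p) | y. y \<in> F x}}"

definition opt_value ::
  "('x \<Rightarrow> 'y::real_normed_vector set) \<Rightarrow> ('x \<times> 'p \<Rightarrow> 'y) \<Rightarrow> ('x \<times> 'p \<Rightarrow> ereal) \<Rightarrow> 'p \<Rightarrow> ereal" where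
  "opt_value F g \<phi> p = (INF x\<in>feasible F g p. \<phi> (x, p))"

definition is_solution ::
  "('x \<Rightarrow> 'y::real_normed_vector set) \<Rightarrow> ('x \<times> 'p \<Rightarrow> 'y) \<Rightarrow> ('x \<times> 'p \<Rightarrow> ereal) \<Rightarrow> 'p \<Rightarrow> 'x \<Rightarrow> bool" where
  "is_solution F g \<phi> p x \<longleftrightarrow>
     x \<in> feasible F g p \<and> (\<forall>x'\<in>feasible F g p. \<phi> (x, p) \<le> \<phi> (x', p))"

definition usc_at :: "('z::topological_space \<Rightarrow> ereal) \<Rightarrow> 'z \<Rightarrow> bool" where
  "usc_at f z \<longleftrightarrow> Limsup (at z) f \<le> f z"

text \<open>Calmness is relative to an explicit metric \<open>d\<close> on the whole domain type.\<close>

definition calm_at ::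
  "('m \<Rightarrow> 'm \<Rightarrow> real) \<Rightarrow> ('m \<Rightarrow> 'n::real_normed_vector) \<Rightarrow> 'm \<Rightarrow> real \<Rightarrow> bool" where
  "calm_at d h mb \<kappa> \<longleftrightarrow>
     \<kappa> \<ge> 0 \<and> (\<exists>\<delta>>0. \<forall>m. d m mb < \<delta> \<longrightarrow> norm (h m - h mb) \<le> \<kappa> * d m mb)"

text \<open>For extended-real functions, calmness includes finiteness near the reference point;
  \<^const>\<open>real_of_ereal\<close> sends infinite values to \<open>0\<close>.\<close>

definition ereal_calm_at :: "('m \<Rightarrow> 'm \<Rightarrow> real) \<Rightarrow> ('m \<Rightarrow> ereal) \<Rightarrow> 'm \<Rightarrow> real \<Rightarrow> bool" where
  "ereal_calm_at d f mb \<kappa> \<longleftrightarrow>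
     (\<exists>\<delta>>0. \<forall>m. d m mb < \<delta> \<longrightarrow> \<bar>f m\<bar> \<noteq> \<infinity>) \<and> calm_at d (\<lambda>m. real_of_ereal (f m)) mb \<kappa>"

definition sum_dist ::
  "('p \<Rightarrow> 'p \<Rightarrow> real) \<Rightarrow> ('x::real_normed_vector \<times> 'p) \<Rightarrow> ('x \<times> 'p) \<Rightarrow> real" where
  "sum_dist \<rho> z z' = norm (fst z - fst z') + \<rho> (snd z) (snd z')"

end

theory Submission
  imports Defs
begin

text \<open>For a parameter \<open>p\<close> near \<open>pb\<close>, Ekeland's principle applied to \<open>norm (y - g (x, p))\<close> on the graph
  of \<open>F\<close> yields either a feasible point at distance \<open>O(norm (g (xb, p) - g (xb, pb)))\<close> from \<open>xb\<close>, or
  a point of the graph that minimizes a Lipschitz function whose slopes in \<open>x\<close> and \<open>y\<close> violate the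
  covering condition as soon as they are realized by a Frechet normal of the graph.

  Such a normal is constructed without separable reduction or smooth renorming. If \<open>v\<close> is a strong
  minimizer of \<open>T\<close> over \<open>G\<close>, the function \<open>m w = INF u\<in>G. T (u - w)\<close> is Lipschitz, its
  subgradients are normals to \<open>G\<close>, and an approximate subgradient exists because the supremum of the
  difference quotients of \<open>m\<close> is a continuous sublinear function of the direction, to which the
  Asplund property applies. Repeating this with \<open>T u = 2 * e * norm (u - v) - z u\<close>, where \<open>z\<close> is the
  \<open>e\<close>-normal just found, and with \<open>e\<close> halved each time, gives an exact normal in the limit.\<close>

section \<open>Ekeland's variational principle and sequences with geometric steps\<close>

text \<open>The relation \<open>u \<in> A x\<close> is transitive with closed sections. Choosing
  each \<open>X (Suc n)\<close> nearly minimal for \<open>f\<close> on \<open>A (X n)\<close> makes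
  the diameters of these nested sets tend to 0. Their common point \<open>v\<close> satisfies
  \<open>A v = {v}\<close>, which is the last conclusion.\<close>

lemma ekeland:
  fixes f :: "'a::complete_space \<Rightarrow> real"
  assumes S: "closed S" "x0 \<in> S" and cont: "continuous_on S f"
    and bd: "\<And>u. u \<in> S \<Longrightarrow> b \<le> f u" and lam: "c > 0"
  obtains v where "v \<in> S" "f v + c * dist x0 v \<le> f x0"
    "\<And>u. u \<in> S \<Longrightarrow> f v \<le> f u + c * dist u v"
proof -
  define A where "A x = {u \<in> S. f u + c * dist x u \<le> f x}" for x
  have A_sub: "A x \<subseteq> S" for x by (auto simp: A_def)
  have A_refl: "x \<in> A x" if "x \<in> S" for x using that by (auto simp: A_def)
  have A_trans: "A y \<subseteq> A x" if "y \<in> A x" for x y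
  proof
    fix u assume "u \<in> A y"
    moreover have "c * dist x u \<le> c * dist x y + c * dist y u"
      using lam dist_triangle[of x u y] by (simp flip: distrib_left)
    ultimately show "u \<in> A x" using that by (auto simp: A_def)
  qed
  have A_closed: "closed (A x)" for x
  proof -
    have "continuous_on S (\<lambda>u. f u + c * dist x u)"
      by (intro continuous_intros cont)
    then show ?thesis
      unfolding A_def using S(1) by (rule continuous_on_closed_Collect_le[OF _ continuous_on_const])
  qed
  have bdd: "bdd_below (f ` A x)" for x
    using bd A_sub by (intro bdd_belowI2[of _ b]) blast
  have step: "\<exists>y. y \<in> S \<and> (y \<in> A x \<and> f y \<le> Inf (f ` A x) + (1/2) ^ n)" if "x \<in> S" for x and n :: nat
  proof -
    have "Inf (f ` A x) < Inf (f ` A x) + (1/2) ^ n" by simp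
    then have "\<exists>y\<in>A x. f y < Inf (f ` A x) + (1/2) ^ n"
      using cInf_lessD[of "f ` A x" "Inf (f ` A x) + (1/2) ^ n"] A_refl[OF that] by blast
    then show ?thesis using A_sub by (auto intro: less_imp_le)
  qed
  obtain X where X0: "X 0 = x0" and XS: "\<And>n. X n \<in> S" and XA: "\<And>n. X (Suc n) \<in> A (X n)"
    and Xf: "\<And>n. f (X (Suc n)) \<le> Inf (f ` A (X n)) + (1/2) ^ n"
  proof -
    have "\<exists>f'. f' 0 = x0 \<and> (\<forall>n. f' n \<in> S) \<and>
            (\<forall>n. f' (Suc n) \<in> A (f' n) \<and> f (f' (Suc n)) \<le> Inf (f ` A (f' n)) + (1/2) ^ n)"
      using dependent_nat_choice[where P = "\<lambda>n x. x \<in> S \<and> (n = 0 \<longrightarrow> x = x0)"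
          and Q = "\<lambda>n x y. y \<in> A x \<and> f y \<le> Inf (f ` A x) + (1/2) ^ n"] step S(2)
      by auto
    then show ?thesis using that by blast
  qed
  have mono: "A (X n) \<subseteq> A (X k)" if "k \<le> n" for k n
    using that by (induction n) (auto simp: le_Suc_eq dest: A_trans[OF XA, THEN subsetD])
  \<comment> \<open>\<open>A (X (Suc n))\<close> lies in \<open>A (X n)\<close>, so
    \<open>f u\<close> is at least the infimum that \<open>X (Suc n)\<close> attains up to
    \<open>(1/2) ^ n\<close>; the definition of \<open>A\<close> turns this gap into a
    distance.\<close>
  have small: "c * dist (X (Suc n)) u \<le> (1/2) ^ n" if "u \<in> A (X (Suc n))" for u n
  proof -
    have "u \<in> A (X n)" using mono[of n "Suc n"] that by auto
    then have "Inf (f ` A (X n)) \<le> f u" using bdd by (simp add: cInf_lower)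
    then show ?thesis using that Xf[of n] by (auto simp: A_def)
  qed
  have diam: "\<exists>n. \<forall>x\<in>A (X n). \<forall>y\<in>A (X n). dist x y < e" if "e > 0" for e
  proof -
    have "e * c / 2 > 0" using that lam by simp
    then obtain n where n: "(1/2::real) ^ n < e * c / 2"
      using real_arch_pow_inv[of "e * c / 2" "1/2"] by auto
    have half: "dist (X (Suc n)) u < e / 2" if "u \<in> A (X (Suc n))" for u
    proof -
      have "c * dist (X (Suc n)) u < c * (e / 2)"
        using small[OF that] n by (simp add: mult.commute)
      then show ?thesis using lam by simp
    qed
    have "dist x y < e" if "x \<in> A (X (Suc n))" "y \<in> A (X (Suc n))" for x y
      using half[OF that(1)] half[OF that(2)] dist_triangle_half_l[of x "X (Suc n)" e y]
      by (simp add: dist_commute)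
    then show ?thesis by blast
  qed
  obtain v where v: "\<And>n. v \<in> A (X n)"
    using decreasing_closed_nest[of "\<lambda>n. A (X n)"] A_closed A_refl XS mono diam by (metis empty_iff)
  show ?thesis
  proof (rule that)
    show "v \<in> S" using v A_sub by blast
    show "f v + c * dist x0 v \<le> f x0" using v[of 0] X0 by (auto simp: A_def)
    fix u assume "u \<in> S"
    show "f v \<le> f u + c * dist u v"
    proof (rule ccontr)
      assume neg: "\<not> ?thesis"
      then have "u \<in> A v" using \<open>u \<in> S\<close> by (auto simp: A_def dist_commute)
      then have uA: "u \<in> A (X n)" for n using A_trans[OF v] by blast
      have "u \<noteq> v" using neg by auto
      then obtain n where "dist u v < dist u v" using diam[of "dist u v"] uA v by (meson zero_less_dist_iff)
      then show False by simp
    qed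
  qed
qed

text \<open>Serves the iteration in \<open>prenormal_near_strong_min\<close> twice, for base points
  and for functionals. The estimates there use the tail bound at every index
  \<open>n\<close>.\<close>

lemma geometric_steps_limit:
  fixes X :: "nat \<Rightarrow> 'a::banach"
  assumes step: "\<And>n. norm (X (Suc n) - X n) \<le> a n" and half: "\<And>n. a (Suc n) \<le> a n / 2"
  obtains l where "X \<longlonglongrightarrow> l" "\<And>n. norm (l - X n) \<le> 2 * a n"
proof -
  have a0: "0 \<le> a n" for n using step[of n] norm_ge_zero order_trans by blast
  have a_geo: "a (n + k) \<le> a n * (1/2) ^ k" for n k
    by (induction k) (use half in \<open>auto intro: order_trans\<close>)
  \<comment> \<open>Keeping the exact partial sum of the geometric series, instead of its limit
    \<open>2 * a n\<close>, lets the induction close.\<close>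
  have bound: "norm (X (n + k) - X n) \<le> 2 * a n * (1 - (1/2) ^ k)" for n k
  proof (induction k)
    case (Suc k)
    have "norm (X (n + Suc k) - X n) \<le> norm (X (Suc (n + k)) - X (n + k)) + norm (X (n + k) - X n)"
      using norm_triangle_ineq[of "X (Suc (n + k)) - X (n + k)" "X (n + k) - X n"] by simp
    also have "\<dots> \<le> a n * (1/2) ^ k + 2 * a n * (1 - (1/2) ^ k)"
      using step[of "n + k"] a_geo[of n k] Suc by linarith
    finally show ?case by (simp add: algebra_simps)
  qed simp
  have bound': "norm (X m - X n) \<le> 2 * a n" if "n \<le> m" for n m
  proof -
    obtain k where m: "m = n + k" using le_Suc_ex[OF \<open>n \<le> m\<close>] by blast
    have "2 * a n * (1 - (1/2) ^ k) \<le> 2 * a n"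
      using a0[of n] by (intro mult_left_le) auto
    then show ?thesis using bound[of n k] by (simp add: m)
  qed
  have "Cauchy X"
  proof (rule metric_CauchyI)
    fix e :: real assume "e > 0"
    have "(\<lambda>k. 2 * (a 0 * (1/2) ^ k)) \<longlonglongrightarrow> 2 * (a 0 * 0)"
      by (intro tendsto_intros LIMSEQ_power_zero) auto
    then have "\<forall>\<^sub>F k in sequentially. 2 * (a 0 * (1/2) ^ k) < e / 2"
      using order_tendstoD(2)[of "\<lambda>k. 2 * (a 0 * (1/2) ^ k)" 0 sequentially "e/2"] \<open>e > 0\<close> by simp
    then obtain N where N: "2 * (a 0 * (1/2) ^ N) < e / 2"
      by (auto simp: eventually_sequentially)
    have near: "norm (X m - X N) < e / 2" if "N \<le> m" for m
      using bound'[OF that] a_geo[of 0 N] N by simp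
    have "norm (X m - X n) < e" if "N \<le> m" "N \<le> n" for m n
      using norm_triangle_half_l[OF near[OF that(1)] near[OF that(2)]] .
    then show "\<exists>M. \<forall>m\<ge>M. \<forall>n\<ge>M. dist (X m) (X n) < e"
      by (auto simp: dist_norm)
  qed
  then obtain l where l: "X \<longlonglongrightarrow> l" using Cauchy_convergent convergent_def by blast
  have "norm (l - X n) \<le> 2 * a n" for n
  proof (rule tendsto_upperbound)
    show "(\<lambda>m. norm (X m - X n)) \<longlonglongrightarrow> norm (l - X n)" by (intro tendsto_intros l)
    show "\<forall>\<^sub>F m in sequentially. norm (X m - X n) \<le> 2 * a n"
      using bound' by (auto simp: eventually_sequentially)
  qed simp
  with l that show ?thesis by blast
qed

section \<open>Epsilon-delta criterion and scaling for the prenormal cone\<close>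

lemma prenormal_coneI:
  fixes z :: "'z::real_normed_vector"
  assumes "\<And>e. e > 0 \<Longrightarrow> \<exists>d>0. \<forall>u\<in>\<Theta>. norm (u - z) < d \<longrightarrow> blinfun_apply \<zeta> (u - z) \<le> e * norm (u - z)"
  shows "\<zeta> \<in> prenormal_cone z \<Theta>"
proof -
  let ?q = "\<lambda>u. ereal (blinfun_apply \<zeta> (u - z) / norm (u - z))"
  have "Limsup (at z within \<Theta>) ?q \<le> 0 + ereal e" if e: "e > 0" for e
  proof -
    obtain d where d: "d > 0" "\<forall>u\<in>\<Theta>. norm (u - z) < d \<longrightarrow> blinfun_apply \<zeta> (u - z) \<le> e * norm (u - z)"
      using assms[OF e] by blast
    then have "\<forall>\<^sub>F u in at z within \<Theta>. ?q u \<le> ereal e"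
      unfolding eventually_at dist_norm by (intro exI[of _ d]) (auto simp: divide_simps)
    then have "Limsup (at z within \<Theta>) ?q \<le> ereal e" by (rule Limsup_bounded)
    then show ?thesis by simp
  qed
  then have "Limsup (at z within \<Theta>) ?q \<le> 0" by (rule ereal_le_epsilon2[rule_format])
  then show ?thesis by (simp add: prenormal_cone_def)
qed

lemma prenormal_cone_scaleR:
  fixes z :: "'z::real_normed_vector"
  assumes "\<zeta> \<in> prenormal_cone z \<Theta>" "c > 0"
  shows "c *\<^sub>R \<zeta> \<in> prenormal_cone z \<Theta>"
proof (rule prenormal_coneI)
  fix e :: real assume "e > 0"
  have "Limsup (at z within \<Theta>) (\<lambda>u. ereal (blinfun_apply \<zeta> (u - z) / norm (u - z))) < ereal (e / c)"
    using assms \<open>e > 0\<close> by (auto simp: prenormal_cone_def zero_ereal_def intro: le_less_trans)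
  then have "\<forall>\<^sub>F u in at z within \<Theta>. ereal (blinfun_apply \<zeta> (u - z) / norm (u - z)) < ereal (e / c)"
    by (rule Limsup_lessD)
  then obtain d where d: "d > 0" "\<And>u. u \<in> \<Theta> \<Longrightarrow> u \<noteq> z \<Longrightarrow> norm (u - z) < d \<Longrightarrow>
      blinfun_apply \<zeta> (u - z) / norm (u - z) < e / c"
    unfolding eventually_at dist_norm by auto
  have "blinfun_apply (c *\<^sub>R \<zeta>) (u - z) \<le> e * norm (u - z)" if u: "u \<in> \<Theta>" "norm (u - z) < d" for u
  proof (cases "u = z")
    case False
    then have "blinfun_apply \<zeta> (u - z) < e / c * norm (u - z)"
      using d(2)[OF u(1) False u(2)] by (simp add: divide_less_eq)
    then show ?thesis using assms(2) by (simp add: blinfun.scaleR_left field_simps)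
  qed simp
  then show "\<exists>d>0. \<forall>u\<in>\<Theta>. norm (u - z) < d \<longrightarrow> blinfun_apply (c *\<^sub>R \<zeta>) (u - z) \<le> e * norm (u - z)"
    using d(1) by blast
qed

subsection \<open>Approximate differentiability of sublinear functions\<close>

definition bounded_sublinear :: "('z::real_normed_vector \<Rightarrow> real) \<Rightarrow> bool" where
  "bounded_sublinear L \<longleftrightarrow>
     (\<forall>x y. L (x + y) \<le> L x + L y) \<and> (\<forall>c x. c > 0 \<longrightarrow> L (c *\<^sub>R x) = c * L x) \<and>
     (\<exists>C. \<forall>x. \<bar>L x\<bar> \<le> C * norm x)"

text \<open>Only the upper half of differentiability is demanded, at one point and up to an error
  \<open>e\<close>. This much passes to products by an elementary argument, so the Asplund property
  is used for the two factors only.\<close>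

definition approx_smooth :: "'z::real_normed_vector itself \<Rightarrow> bool" where
  "approx_smooth _ \<longleftrightarrow>
     (\<forall>(L :: 'z \<Rightarrow> real) e. bounded_sublinear L \<and> e > 0 \<longrightarrow>
        (\<exists>x (\<zeta> :: 'z \<Rightarrow>\<^sub>L real) d. d > 0 \<and> (\<forall>k. norm k \<le> d \<longrightarrow> L (x + k) \<le> L x + \<zeta> k + e * norm k)))"

lemma asplund_approx_smooth_point:
  fixes f :: "'z::banach \<Rightarrow> real"
  assumes "asplund TYPE('z)" "convex_on UNIV f" "continuous_on UNIV f" "r > 0" "e > 0"
  obtains x and \<zeta> :: "'z \<Rightarrow>\<^sub>L real" and d where "norm (x - a) < r" "d > 0"
    "\<And>k. norm k \<le> d \<Longrightarrow> f (x + k) \<le> f x + \<zeta> k + e * norm k"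
proof -
  have "UNIV \<subseteq> closure {z \<in> UNIV. f differentiable (at z)}"
    using assms(1-3) unfolding asplund_def by (metis convex_UNIV open_UNIV)
  then have "a \<in> closure {z. f differentiable (at z)}" by auto
  then obtain x where x: "f differentiable (at x)" "dist x a < r"
    using assms(4) unfolding closure_approachable by blast
  then obtain D where D: "(f has_derivative D) (at x)" unfolding differentiable_def by blast
  then obtain d where d: "d > 0" "\<And>y. norm (y - x) < d \<Longrightarrow> norm (f y - f x - D (y - x)) \<le> e * norm (y - x)"
    unfolding has_derivative_at_alt using assms(5) by meson
  have bl: "bounded_linear D" using D by (rule has_derivative_bounded_linear)
  show ?thesis
  proof (rule that[of x "d/2" "Blinfun D"])
    show "norm (x - a) < r" using x by (simp add: dist_norm)
    fix k :: 'z assume "norm k \<le> d / 2"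
    then have "norm (f (x + k) - f x - D k) \<le> e * norm k" using d(2)[of "x + k"] d(1) by simp
    then show "f (x + k) \<le> f x + blinfun_apply (Blinfun D) k + e * norm k"
      by (simp add: bounded_linear_Blinfun_apply[OF bl])
  qed (use d in simp)
qed

lemma bounded_sublinear_lipschitz:
  assumes "bounded_sublinear L"
  obtains C where "C > 0" "\<And>x y. \<bar>L x - L y\<bar> \<le> C * norm (x - y)"
proof -
  obtain C where C: "\<And>x. \<bar>L x\<bar> \<le> C * norm x" using assms unfolding bounded_sublinear_def by blast
  have add: "L (x + y) \<le> L x + L y" for x y using assms unfolding bounded_sublinear_def by blast
  have le: "L x - L y \<le> (\<bar>C\<bar> + 1) * norm (x - y)" for x y
  proof -
    have "L x \<le> L y + L (x - y)" using add[of y "x - y"] by simp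
    also have "L (x - y) \<le> C * norm (x - y)" using C[of "x - y"] by linarith
    also have "\<dots> \<le> (\<bar>C\<bar> + 1) * norm (x - y)" by (intro mult_right_mono) auto
    finally show ?thesis by simp
  qed
  have "\<bar>L x - L y\<bar> \<le> (\<bar>C\<bar> + 1) * norm (x - y)" for x y
    using le[of x y] le[of y x] by (simp add: norm_minus_commute)
  then show ?thesis using that[of "\<bar>C\<bar> + 1"] by auto
qed

lemma bounded_sublinear_convex:
  assumes "bounded_sublinear L"
  shows "convex_on UNIV L"
proof (rule convex_onI)
  fix t :: real and x y assume "0 < t" "t < 1"
  then have "L ((1 - t) *\<^sub>R x + t *\<^sub>R y) \<le> L ((1 - t) *\<^sub>R x) + L (t *\<^sub>R y)"
    using assms unfolding bounded_sublinear_def by blast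
  also have "\<dots> = (1 - t) * L x + t * L y"
    using assms \<open>0 < t\<close> \<open>t < 1\<close> unfolding bounded_sublinear_def by simp
  finally show "L ((1 - t) *\<^sub>R x + t *\<^sub>R y) \<le> (1 - t) * L x + t * L y" .
qed auto

text \<open>First \<open>x0\<close> is chosen for \<open>L (_, 0)\<close>, then a small
  \<open>y0\<close> for \<open>L (x0, _)\<close>. Since \<open>L\<close> is Lipschitz, the estimate
  in \<open>x\<close> persists for small \<open>y\<close>, and the two partial estimates add up at
  \<open>(x0, y0)\<close>.\<close>

lemma approx_smooth_prod:
  assumes "asplund TYPE('x::banach)" "asplund TYPE('y::banach)"
  shows "approx_smooth TYPE('x \<times> 'y)"
  unfolding approx_smooth_def
proof (intro allI impI, elim conjE)
  fix L :: "'x \<times> 'y \<Rightarrow> real" and e :: real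
  assume L: "bounded_sublinear L" and e: "e > 0"
  obtain C where C: "C > 0" "\<And>u v. \<bar>L u - L v\<bar> \<le> C * norm (u - v)"
    using bounded_sublinear_lipschitz[OF L] by blast
  have conv: "convex_on UNIV L" using L by (rule bounded_sublinear_convex)
  have cvx1: "convex_on UNIV (\<lambda>x. L (x, y))" for y
  proof (rule convex_onI)
    fix t :: real and x x' assume "0 < t" "t < 1"
    then show "L ((1 - t) *\<^sub>R x + t *\<^sub>R x', y) \<le> (1 - t) * L (x, y) + t * L (x', y)"
      using convex_onD[OF conv, of t "(x, y)" "(x', y)"] by (simp flip: scaleR_add_left)
  qed auto
  have cvx2: "convex_on UNIV (\<lambda>y. L (x, y))" for x
  proof (rule convex_onI)
    fix t :: real and y y' assume "0 < t" "t < 1"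
    then show "L (x, (1 - t) *\<^sub>R y + t *\<^sub>R y') \<le> (1 - t) * L (x, y) + t * L (x, y')"
      using convex_onD[OF conv, of t "(x, y)" "(x, y')"] by (simp flip: scaleR_add_left)
  qed auto
  have cont: "continuous_on UNIV L"
    using C by (intro lipschitz_on_continuous_on[of C] lipschitz_onI) (auto simp: dist_norm)
  have cont1: "continuous_on UNIV (\<lambda>x. L (x, 0))" and cont2: "continuous_on UNIV (\<lambda>y. L (x, y))" for x
    by (intro continuous_on_compose2[OF cont] continuous_intros; simp)+
  obtain x0 and \<xi> :: "'x \<Rightarrow>\<^sub>L real" and d where d: "d > 0"
    and x0: "\<And>h. norm h \<le> d \<Longrightarrow> L (x0 + h, 0) \<le> L (x0, 0) + \<xi> h + e / 4 * norm h"
    using asplund_approx_smooth_point[OF assms(1) cvx1 cont1, of 1 "e/4"] e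
    by (metis divide_pos_pos zero_less_numeral zero_less_one)
  \<comment> \<open>Changing \<open>y\<close> by at most \<open>\<rho>\<close> alters
    \<open>L\<close> at both ends of a step of length \<open>d\<close> by at most
    \<open>C * \<rho>\<close>, together \<open>e * d / 4\<close>. This raises the error rate from
    \<open>e / 4\<close> to \<open>e / 2\<close>.\<close>
  define \<rho> where "\<rho> = e * d / (8 * C)"
  have \<rho>: "\<rho> > 0" using e d C by (simp add: \<rho>_def)
  obtain y0 and \<upsilon> :: "'y \<Rightarrow>\<^sub>L real" and d' where d': "d' > 0" and y0n: "norm y0 < \<rho> / 2"
    and y0: "\<And>k. norm k \<le> d' \<Longrightarrow> L (x0, y0 + k) \<le> L (x0, y0) + \<upsilon> k + e / 2 * norm k"
    using asplund_approx_smooth_point[OF assms(2) cvx2 cont2, of "\<rho>/2" "e/2" 0 x0] e \<rho>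
    by (metis diff_zero half_gt_zero)
  \<comment> \<open>The upper estimate at \<open>(x0, 0)\<close> survives small changes of \<open>y\<close>: difference quotients of a
    convex function increase with the step, so only the step of length \<open>d\<close> matters.\<close>
  have xpart: "L (x0 + h, y) - L (x0, y) \<le> \<xi> h + e / 2 * norm h" if h: "norm h \<le> d" and y: "norm y \<le> \<rho>" for h y
  proof (cases "h = 0")
    case False
    define t where "t = norm h / d"
    have t: "0 < t" "t \<le> 1" using False h d by (auto simp: t_def)
    define g where "g = (1/t) *\<^sub>R h"
    have ng: "norm g = d" using False d by (simp add: g_def t_def)
    have hg: "h = t *\<^sub>R g" using t by (simp add: g_def)
    have "L (x0 + h, y) \<le> (1 - t) * L (x0, y) + t * L (x0 + g, y)"
      using convex_onD[OF cvx1, of t x0 "x0 + g" y] t by (simp add: hg algebra_simps)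
    then have "L (x0 + h, y) - L (x0, y) \<le> t * (L (x0 + g, y) - L (x0, y))"
      by (simp add: algebra_simps)
    also have "\<dots> \<le> t * (\<xi> g + e / 4 * d + 2 * (C * \<rho>))"
    proof (rule mult_left_mono)
      have "\<bar>L (x, y) - L (x, 0)\<bar> \<le> C * \<rho>" for x
      proof -
        have "\<bar>L (x, y) - L (x, 0)\<bar> \<le> C * norm y" using C(2)[of "(x, y)" "(x, 0)"] by simp
        also have "\<dots> \<le> C * \<rho>" using y C by (intro mult_left_mono) auto
        finally show ?thesis .
      qed
      from this[of x0] this[of "x0 + g"] x0[of g] ng
      show "L (x0 + g, y) - L (x0, y) \<le> \<xi> g + e / 4 * d + 2 * (C * \<rho>)" by (simp add: abs_le_iff)
    qed (use t in simp)
    also have "2 * (C * \<rho>) = e / 4 * d" using C by (simp add: \<rho>_def)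
    also have "t * (\<xi> g + e / 4 * d + e / 4 * d) = \<xi> h + e / 2 * norm h"
      using d by (simp add: hg ng blinfun.scaleR_right algebra_simps t(1) less_imp_le)
    finally show ?thesis .
  qed simp
  define \<delta> where "\<delta> = min d (min d' (\<rho> / 2))"
  define \<zeta> where "\<zeta> = dual_pair \<xi> \<upsilon>"
  have "L ((x0, y0) + k) \<le> L (x0, y0) + \<zeta> k + e * norm k" if k: "norm k \<le> \<delta>" for k
  proof -
    obtain h q where kq: "k = (h, q)" by fastforce
    have nh: "norm h \<le> norm k" and nq: "norm q \<le> norm k"
      using norm_fst_le[of h q] norm_snd_le[of q h] by (auto simp: kq)
    have "norm (y0 + q) \<le> \<rho>" using norm_triangle_ineq[of y0 q] y0n nq k by (simp add: \<delta>_def)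
    then have "L (x0 + h, y0 + q) - L (x0, y0 + q) \<le> \<xi> h + e / 2 * norm h"
      using nh k by (intro xpart) (auto simp: \<delta>_def)
    moreover have "L (x0, y0 + q) \<le> L (x0, y0) + \<upsilon> q + e / 2 * norm q"
      using nq k by (intro y0) (auto simp: \<delta>_def)
    moreover have "e / 2 * norm h \<le> e / 2 * norm k" "e / 2 * norm q \<le> e / 2 * norm k"
      using nh nq e by auto
    moreover have "\<zeta> k = \<xi> h + \<upsilon> q"
      by (simp add: \<zeta>_def dual_pair_def kq blinfun.add_left fst_blinfun.rep_eq snd_blinfun.rep_eq)
    ultimately show ?thesis by (simp add: kq)
  qed
  moreover have "\<delta> > 0" using d d' \<rho> by (simp add: \<delta>_def)
  ultimately show "\<exists>x (\<zeta> :: ('x \<times> 'y) \<Rightarrow>\<^sub>L real) d. d > 0 \<and>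
      (\<forall>k. norm k \<le> d \<longrightarrow> L (x + k) \<le> L x + \<zeta> k + e * norm k)"
    by blast
qed

text \<open>A Lipschitz function \<open>m\<close> has an \<open>e\<close>-subgradient near \<open>0\<close>: the supremum \<open>L x\<close> of its difference
  quotients in direction \<open>x\<close> is sublinear in \<open>x\<close>. At a direction where \<open>L\<close> is almost Frechet
  differentiable, a point where \<open>m\<close> grows almost as fast as \<open>L x\<close> allows no drop of \<open>m\<close> in any
  other direction beyond the linear rate, since otherwise a nearby direction would beat \<open>L\<close>.\<close>

lemma lipschitz_approx_subgradient:
  fixes m :: "'z::real_normed_vector \<Rightarrow> real"
  assumes sm: "approx_smooth TYPE('z)" and lip: "\<And>u v. \<bar>m u - m v\<bar> \<le> C * norm (u - v)"
    and s: "s > 0" and e: "e > 0"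
  obtains w and \<zeta> :: "'z \<Rightarrow>\<^sub>L real" and r where "norm w < s" "r > 0"
    "\<And>h. norm h \<le> r \<Longrightarrow> m w + \<zeta> h - e * norm h \<le> m (w + h)"
    "\<And>h M. (\<And>w t. t > 0 \<Longrightarrow> norm w < s \<Longrightarrow> norm (w + t *\<^sub>R h) < s \<Longrightarrow> m (w + t *\<^sub>R h) - m w \<le> t * M)
       \<Longrightarrow> \<zeta> h \<le> M + e * norm h"
proof -
  define Q where "Q x = {(m (w + t *\<^sub>R x) - m w) / t | w t. t > 0 \<and> norm w < s \<and> norm (w + t *\<^sub>R x) < s}" for x
  define L where "L x = Sup (Q x)" for x
  have Q_ne: "Q x \<noteq> {}" for x
  proof -
    define t where "t = s / (2 * (norm x + 1))"
    have "t > 0" using s by (simp add: t_def add_nonneg_pos)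
    moreover have "t * norm x < s"
    proof -
      have "t * norm x \<le> t * (norm x + 1)" using \<open>t > 0\<close> by simp
      also have "\<dots> = s / 2" by (simp add: t_def add_nonneg_eq_0_iff field_simps)
      finally show ?thesis using s by simp
    qed
    ultimately have "(m (0 + t *\<^sub>R x) - m 0) / t \<in> Q x"
      using s unfolding Q_def by (intro CollectI exI[of _ 0] exI[of _ t]) auto
    then show ?thesis by blast
  qed
  have Q_abs: "\<bar>q\<bar> \<le> C * norm x" if qQ: "q \<in> Q x" for q x
  proof -
    obtain w t where q: "q = (m (w + t *\<^sub>R x) - m w) / t" "t > 0" using qQ by (auto simp: Q_def)
    have "\<bar>m (w + t *\<^sub>R x) - m w\<bar> \<le> t * (C * norm x)"
      using lip[of "w + t *\<^sub>R x" w] q(2) by (simp add: mult.left_commute)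
    then show ?thesis using q by (simp add: abs_divide divide_le_eq mult.commute)
  qed
  have bdd: "bdd_above (Q x)" for x
    using Q_abs[of _ x] by (intro bdd_aboveI[of _ "C * norm x"]) (auto simp: abs_le_iff)
  have L_ub: "m (w + t *\<^sub>R x) - m w \<le> t * L x" if "t > 0" "norm w < s" "norm (w + t *\<^sub>R x) < s" for w t x
  proof -
    have "(m (w + t *\<^sub>R x) - m w) / t \<le> L x"
      unfolding L_def using that by (intro cSup_upper bdd) (auto simp: Q_def)
    then show ?thesis using that(1) by (simp add: divide_le_eq mult.commute)
  qed
  have L_least: "L x \<le> M"
    if "\<And>w t. t > 0 \<Longrightarrow> norm w < s \<Longrightarrow> norm (w + t *\<^sub>R x) < s \<Longrightarrow> m (w + t *\<^sub>R x) - m w \<le> t * M" for x M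
    unfolding L_def by (rule cSup_least[OF Q_ne]) (use that in \<open>auto simp: Q_def divide_le_eq mult.commute\<close>)
  have L_abs: "\<bar>L x\<bar> \<le> C * norm x" for x
  proof -
    obtain q where q: "q \<in> Q x" using Q_ne by blast
    have "q \<le> L x" unfolding L_def by (rule cSup_upper[OF q bdd])
    moreover have "L x \<le> C * norm x"
      unfolding L_def by (rule cSup_least[OF Q_ne]) (use Q_abs abs_le_iff in blast)
    ultimately show ?thesis using Q_abs[OF q] by linarith
  qed
  have L_add: "L (x + y) \<le> L x + L y" for x y
  proof (rule L_least)
    fix w t assume t: "t > 0" and w: "norm w < s" and w': "norm (w + t *\<^sub>R (x + y)) < s"
    \<comment> \<open>The intermediate point \<open>w + t *\<^sub>R x\<close> may leave the ball of
      radius \<open>s\<close>. The segment from \<open>w\<close> to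
      \<open>w + t *\<^sub>R (x + y)\<close> has norms at most \<open>R\<close>; when it is cut into
      \<open>n\<close> pieces, each detour along \<open>x\<close> is shorter than
      \<open>s - R\<close> and stays inside.\<close>
    define R where "R = max (norm w) (norm (w + t *\<^sub>R (x + y)))"
    have R: "R < s" using w w' by (simp add: R_def)
    obtain n :: nat where n: "t * norm x / (s - R) < n" using reals_Archimedean2 by blast
    have "0 \<le> t * norm x / (s - R)" using t R by simp
    then have n0: "n > 0" using n by (cases n) auto
    define \<tau> where "\<tau> = t / n"
    have \<tau>: "\<tau> > 0" using t n0 by (simp add: \<tau>_def)
    have tx: "\<tau> * norm x < s - R"
      using n n0 R by (simp add: \<tau>_def field_simps)
    define p where "p i = w + (real i * \<tau>) *\<^sub>R (x + y)" for i
    have pR: "norm (p i) \<le> R" if "i \<le> n" for i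
    proof -
      define a where "a = real i / n"
      have a: "0 \<le> a" "a \<le> 1" using that n0 by (auto simp: a_def)
      have "p i = (1 - a) *\<^sub>R w + a *\<^sub>R (w + t *\<^sub>R (x + y))"
        using n0 by (simp add: p_def a_def \<tau>_def algebra_simps)
      also have "norm \<dots> \<le> (1 - a) * norm w + a * norm (w + t *\<^sub>R (x + y))"
        using norm_triangle_ineq[of "(1 - a) *\<^sub>R w" "a *\<^sub>R (w + t *\<^sub>R (x + y))"] a by simp
      also have "\<dots> \<le> (1 - a) * R + a * R"
        using a by (intro add_mono mult_left_mono) (auto simp: R_def)
      finally show ?thesis by (simp add: algebra_simps)
    qed
    have step: "m (p (Suc i)) - m (p i) \<le> \<tau> * (L x + L y)" if "i < n" for i
    proof -
      have q: "norm (p i + \<tau> *\<^sub>R x) < s"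
        using norm_triangle_ineq[of "p i" "\<tau> *\<^sub>R x"] pR[of i] tx \<tau> that by simp
      have pS: "p i + \<tau> *\<^sub>R x + \<tau> *\<^sub>R y = p (Suc i)" by (simp add: p_def algebra_simps)
      have "m (p i + \<tau> *\<^sub>R x) - m (p i) \<le> \<tau> * L x"
        using pR[of i] R that by (intro L_ub \<tau> q) simp
      moreover have "m (p i + \<tau> *\<^sub>R x + \<tau> *\<^sub>R y) - m (p i + \<tau> *\<^sub>R x) \<le> \<tau> * L y"
        using pR[of "Suc i"] R that by (intro L_ub \<tau> q) (simp add: pS)
      ultimately show ?thesis unfolding pS by (simp add: distrib_left)
    qed
    have "m (p n) - m (p 0) = (\<Sum>i<n. m (p (Suc i)) - m (p i))"
      by (rule sum_lessThan_telescope[symmetric, where f = "\<lambda>i. m (p i)"])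
    also have "\<dots> \<le> (\<Sum>i<n. \<tau> * (L x + L y))" using step by (intro sum_mono) simp
    also have "\<dots> = t * (L x + L y)" using n0 by (simp add: \<tau>_def)
    finally show "m (w + t *\<^sub>R (x + y)) - m w \<le> t * (L x + L y)"
      using n0 by (simp add: p_def \<tau>_def)
  qed
  have L_scale_le: "L (c *\<^sub>R x) \<le> c * L x" if "c > 0" for c x
  proof (rule L_least)
    fix w t assume "t > 0" "norm w < s" "norm (w + t *\<^sub>R c *\<^sub>R x) < s"
    then show "m (w + t *\<^sub>R c *\<^sub>R x) - m w \<le> t * (c * L x)"
      using L_ub[of "t * c" w x] that by (simp add: mult.assoc)
  qed
  have L_scale: "L (c *\<^sub>R x) = c * L x" if "c > 0" for c x
  proof (rule antisym[OF L_scale_le[OF that]])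
    have "L x \<le> inverse c * L (c *\<^sub>R x)" using L_scale_le[of "inverse c" "c *\<^sub>R x"] that by simp
    then show "c * L x \<le> L (c *\<^sub>R x)" using that by (simp add: field_simps)
  qed
  have "bounded_sublinear L"
    unfolding bounded_sublinear_def using L_add L_scale L_abs by blast
  then have "\<exists>x (\<zeta> :: 'z \<Rightarrow>\<^sub>L real) d. d > 0 \<and>
      (\<forall>k. norm k \<le> d \<longrightarrow> L (x + k) \<le> L x + \<zeta> k + e / 2 * norm k)"
    using sm[unfolded approx_smooth_def, rule_format, of L "e / 2"] e by simp
  then obtain x and \<zeta> :: "'z \<Rightarrow>\<^sub>L real" and d where d: "d > 0"
    and x: "\<And>k. norm k \<le> d \<Longrightarrow> L (x + k) \<le> L x + \<zeta> k + e / 2 * norm k"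
    by blast
  \<comment> \<open>The upper estimate for the step \<open>- c h\<close> of length \<open>d\<close>,
    combined with \<open>L x \<le> L (x - c h) + c * L h\<close>, bounds \<open>\<zeta> h\<close> by
    \<open>L h\<close> from above.\<close>
  have \<zeta>L: "\<zeta> h \<le> L h + e * norm h" for h
  proof (cases "h = 0")
    case True
    then show ?thesis using L_abs[of 0] by simp
  next
    case False
    define c where "c = d / norm h"
    have c: "c > 0" using False d by (simp add: c_def)
    have "L x \<le> L (x + c *\<^sub>R (- h)) + c * L h"
      using L_add[of "x + c *\<^sub>R (- h)" "c *\<^sub>R h"] L_scale[OF c, of h] by simp
    also have "L (x + c *\<^sub>R (- h)) \<le> L x + \<zeta> (c *\<^sub>R (- h)) + e / 2 * norm (c *\<^sub>R (- h))"
      using False d by (intro x) (simp add: c_def)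
    finally have "c * \<zeta> h \<le> c * (L h + e / 2 * norm h)"
      using c by (simp add: blinfun.scaleR_right blinfun.minus_right algebra_simps)
    then have "\<zeta> h \<le> L h + e / 2 * norm h" using c by simp
    also have "\<dots> \<le> L h + e * norm h" using e by (simp add: mult_right_mono)
    finally show ?thesis .
  qed
  \<comment> \<open>With \<open>\<tau> = norm h / d\<close> below,
    \<open>2 * \<eta> * \<tau>\<close> equals \<open>e / 2 * norm h\<close>; the other half of the
    error comes from the estimate for \<open>L\<close>.\<close>
  define \<eta> where "\<eta> = e * d / 4"
  have \<eta>: "\<eta> > 0" using e d by (simp add: \<eta>_def)
  obtain w0 t where t: "t > 0" and w0: "norm w0 < s" and w0t: "norm (w0 + t *\<^sub>R x) < s"
    and slope: "L x - \<eta> < (m (w0 + t *\<^sub>R x) - m w0) / t"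
  proof -
    have "L x - \<eta> < Sup (Q x)" using \<eta> by (simp add: L_def)
    then obtain q where "q \<in> Q x" "L x - \<eta> < q" using less_cSupE[OF _ Q_ne] by metis
    then show ?thesis using that by (auto simp: Q_def)
  qed
  \<comment> \<open>The mean slope of \<open>m\<close> from \<open>w0\<close> to
    \<open>w0 + t *\<^sub>R x\<close> exceeds \<open>L x - \<eta>\<close>, so after the slope
    \<open>L x - 2 * \<eta>\<close> is subtracted the end value still lies above the starting value.
    The minimum is attained before \<open>t\<close>, and from there on \<open>m\<close> stays above
    the line of slope \<open>L x - 2 * \<eta>\<close>.\<close>
  define a where "a \<sigma> = m (w0 + \<sigma> *\<^sub>R x) - (L x - 2 * \<eta>) * \<sigma>" for \<sigma>
  have "continuous_on UNIV m"
  proof (rule continuous_onI)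
    fix u and r :: real assume r: "r > 0"
    have "dist (m v) (m u) \<le> r" if "dist v u < r / (\<bar>C\<bar> + 1)" for v
    proof -
      have "dist (m v) (m u) \<le> (\<bar>C\<bar> + 1) * dist v u"
      proof -
        have "C * norm (v - u) \<le> (\<bar>C\<bar> + 1) * norm (v - u)" by (intro mult_right_mono) auto
        then show ?thesis using lip[of v u] by (simp add: dist_norm)
      qed
      also have "\<dots> \<le> r" using that by (simp add: pos_less_divide_eq mult.commute)
      finally show ?thesis .
    qed
    then show "\<exists>d>0. \<forall>v\<in>UNIV. dist v u < d \<longrightarrow> dist (m v) (m u) \<le> r"
      using r by (intro exI[of _ "r / (\<bar>C\<bar> + 1)"]) auto
  qed
  then have "continuous_on {0..t} (\<lambda>\<sigma>. m (w0 + \<sigma> *\<^sub>R x))"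
    by (rule continuous_on_compose2) (auto intro!: continuous_intros)
  then have "continuous_on {0..t} a"
    unfolding a_def by (intro continuous_intros)
  then obtain \<sigma>0 where \<sigma>0: "\<sigma>0 \<in> {0..t}" and min: "\<And>\<sigma>. \<sigma> \<in> {0..t} \<Longrightarrow> a \<sigma>0 \<le> a \<sigma>"
    using continuous_attains_inf[of "{0..t}" a] t by auto
  have "m w0 + (L x - \<eta>) * t < m (w0 + t *\<^sub>R x)" using slope t by (simp add: pos_less_divide_eq)
  then have "a 0 < a t" using mult_pos_pos[OF \<eta> t] by (simp add: a_def algebra_simps)
  then have \<sigma>0t: "\<sigma>0 < t" using min[of 0] \<sigma>0 t by (cases "\<sigma>0 = t") auto
  have seg: "norm (w0 + \<sigma> *\<^sub>R x) < s" if "\<sigma> \<in> {0..t}" for \<sigma>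
  proof -
    define b where "b = \<sigma> / t"
    have b: "0 \<le> b" "b \<le> 1" "\<sigma> = b * t" using that t by (auto simp: b_def)
    have "w0 + \<sigma> *\<^sub>R x = (1 - b) *\<^sub>R w0 + b *\<^sub>R (w0 + t *\<^sub>R x)" by (simp add: b(3) algebra_simps)
    moreover have "(1 - b) *\<^sub>R w0 + b *\<^sub>R (w0 + t *\<^sub>R x) \<in> ball 0 s"
      using convexD_alt[OF convex_ball, of w0 0 s "w0 + t *\<^sub>R x" b] w0 w0t b by simp
    ultimately show ?thesis by simp
  qed
  define w where "w = w0 + \<sigma>0 *\<^sub>R x"
  have ws: "norm w < s" using seg[OF \<sigma>0] by (simp add: w_def)
  have grow: "m w + (L x - 2 * \<eta>) * \<tau> \<le> m (w + \<tau> *\<^sub>R x)" and inball: "norm (w + \<tau> *\<^sub>R x) < s"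
    if "0 \<le> \<tau>" "\<tau> \<le> t - \<sigma>0" for \<tau>
    using min[of "\<sigma>0 + \<tau>"] seg[of "\<sigma>0 + \<tau>"] that \<sigma>0 by (auto simp: a_def w_def algebra_simps)
  define r where "r = min (d * (t - \<sigma>0)) ((s - norm w) / 2)"
  have "r > 0" using d \<sigma>0t ws by (simp add: r_def)
  moreover have "m w + \<zeta> h - e * norm h \<le> m (w + h)" if h: "norm h \<le> r" for h
  proof (cases "h = 0")
    case False
    define \<tau> where "\<tau> = norm h / d"
    have \<tau>: "\<tau> > 0" using False d by (simp add: \<tau>_def)
    have \<tau>t: "\<tau> \<le> t - \<sigma>0" using h d by (simp add: \<tau>_def r_def divide_le_eq mult.commute)
    \<comment> \<open>From \<open>w + h\<close> the direction \<open>x + k\<close> leads in time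
      \<open>\<tau>\<close> to \<open>w + \<tau> *\<^sub>R x\<close>. There \<open>m\<close> is
      large, and on the way it rises at most at rate \<open>L (x + k)\<close>, so it cannot be small
      at \<open>w + h\<close>.\<close>
    define k where "k = - (inverse \<tau> *\<^sub>R h)"
    have k: "norm k = d" "\<tau> *\<^sub>R k = - h" using False d \<tau> by (auto simp: k_def \<tau>_def)
    have eq: "w + h + \<tau> *\<^sub>R (x + k) = w + \<tau> *\<^sub>R x" by (simp add: k(2) scaleR_add_right)
    have "m (w + h + \<tau> *\<^sub>R (x + k)) - m (w + h) \<le> \<tau> * L (x + k)"
    proof (rule L_ub[OF \<tau>])
      show "norm (w + h) < s" using norm_triangle_ineq[of w h] h ws by (simp add: r_def)
      show "norm (w + h + \<tau> *\<^sub>R (x + k)) < s" using inball[of \<tau>] \<tau> \<tau>t by (simp add: eq)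
    qed
    also have "\<dots> \<le> \<tau> * (L x + \<zeta> k + e / 2 * d)"
      using x[of k] k \<tau> by simp
    also have "\<dots> = \<tau> * L x - \<zeta> h + e / 2 * norm h"
    proof -
      have "\<tau> * \<zeta> k = - \<zeta> h" using k(2) by (metis blinfun.minus_right blinfun.scaleR_right real_scaleR_def)
      then show ?thesis using d by (simp add: distrib_left \<tau>_def)
    qed
    finally have "m (w + \<tau> *\<^sub>R x) - m (w + h) \<le> \<tau> * L x - \<zeta> h + e / 2 * norm h" by (simp only: eq)
    moreover have "2 * \<eta> * \<tau> = e / 2 * norm h" using d by (simp add: \<eta>_def \<tau>_def)
    ultimately show ?thesis using grow[of \<tau>] \<tau> \<tau>t by (simp add: algebra_simps)
  qed simp
  moreover have "\<zeta> h \<le> M + e * norm h"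
    if "\<And>w t. t > 0 \<Longrightarrow> norm w < s \<Longrightarrow> norm (w + t *\<^sub>R h) < s \<Longrightarrow> m (w + t *\<^sub>R h) - m w \<le> t * M" for h M
    using \<zeta>L[of h] L_least[OF that] by fastforce
  ultimately show ?thesis using that ws by blast
qed

subsection \<open>Normals near strong minimizers\<close>

text \<open>The last conclusion records that \<open>v'\<close> is almost minimal at all scales above \<open>r'\<close>; below \<open>r'\<close>
  the normal \<open>\<zeta>\<close> takes over. Together they control all scales, so the construction can be iterated.\<close>

lemma approx_normal_near_strong_min:
  fixes G :: "'z::banach set" and T :: "'z \<Rightarrow> real"
  assumes sm: "approx_smooth TYPE('z)"
    and G: "closed (G \<inter> cball v r)" "v \<in> G" and r: "r > 0"
    and lip: "\<And>a b. \<bar>T a - T b\<bar> \<le> C * norm (a - b)" and C: "C \<ge> 0"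
    and c: "c > 0" and min: "\<And>u. u \<in> G \<Longrightarrow> norm (u - v) \<le> r \<Longrightarrow> T v + c * norm (u - v) \<le> T u"
    and \<rho>: "\<rho> > 0" and e: "e > 0"
  obtains v' and \<zeta> :: "'z \<Rightarrow>\<^sub>L real" and r' where "v' \<in> G" "norm (v' - v) \<le> \<rho>" "r' > 0"
    "\<And>u. u \<in> G \<Longrightarrow> norm (u - v') \<le> r' \<Longrightarrow> \<zeta> (u - v') \<le> e * norm (u - v')"
    "\<And>h M. (\<And>u t. t > 0 \<Longrightarrow> norm (u - v) < 2 * r \<Longrightarrow> norm (u - t *\<^sub>R h - v) < 2 * r \<Longrightarrow>
        T (u - t *\<^sub>R h) - T u \<le> t * M) \<Longrightarrow> \<zeta> h \<le> M + e * norm h"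
    "\<And>u. u \<in> G \<Longrightarrow> norm (u - v) \<le> r \<Longrightarrow> r' \<le> norm (u - v') \<Longrightarrow>
        \<exists>w. T (v' - w) \<le> T (u - w) + e * norm (u - v')"
proof -
  define S where "S = G \<inter> cball v r"
  have vS: "v \<in> S" using G r by (simp add: S_def)
  define m where "m w = (INF u\<in>S. T (u - w))" for w
  have bdd: "bdd_below ((\<lambda>u. T (u - w)) ` S)" for w
  proof (rule bdd_belowI2)
    fix u assume "u \<in> S"
    then have "norm (u - v) \<le> r" by (simp add: S_def dist_norm norm_minus_commute)
    then have "norm (u - w - v) \<le> r + norm w"
      using norm_triangle_ineq4[of "u - v" w] by (simp add: algebra_simps)
    then have "C * norm (u - w - v) \<le> C * (r + norm w)" using C by (intro mult_left_mono)
    then show "T v - C * (r + norm w) \<le> T (u - w)" using lip[of "u - w" v] by (simp add: abs_le_iff)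
  qed
  have m_le: "m w \<le> T (u - w)" if "u \<in> S" for u w
    unfolding m_def by (rule cINF_lower[OF bdd that])
  have m_ge: "b \<le> m w" if "\<And>u. u \<in> S \<Longrightarrow> b \<le> T (u - w)" for b w
    unfolding m_def using vS that by (intro cINF_greatest) auto
  have m_lip1: "m w - C * norm (w - w') \<le> m w'" for w w'
  proof (rule m_ge)
    fix u assume "u \<in> S"
    then have "m w \<le> T (u - w)" by (rule m_le)
    then show "m w - C * norm (w - w') \<le> T (u - w')"
      using lip[of "u - w" "u - w'"] by (simp add: norm_minus_commute abs_le_iff)
  qed
  have m_lip: "\<bar>m w - m w'\<bar> \<le> C * norm (w - w')" for w w'
    using m_lip1[of w w'] m_lip1[of w' w] by (simp add: norm_minus_commute abs_le_iff)
  define \<rho>' where "\<rho>' = min \<rho> r"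
  have \<rho>': "\<rho>' > 0" "\<rho>' \<le> r" "\<rho>' \<le> \<rho>" using \<rho> r by (auto simp: \<rho>'_def)
  \<comment> \<open>A shift by \<open>w\<close> with \<open>norm w < s\<close> changes
    \<open>T\<close> by at most \<open>C * s\<close>. Against the growth
    \<open>c * norm (u - v)\<close> this is small enough to keep near minimizers of the shifted
    function within \<open>\<rho>' / 4\<close> of \<open>v\<close>.\<close>
  define s where "s = min r (c * \<rho>' / (16 * (C + 1)))"
  have s: "s > 0" "s \<le> r" using r c \<rho>' C by (auto simp: s_def)
  have Cs: "2 * (C * s) \<le> c * \<rho>' / 8"
  proof -
    have "C * s \<le> (C + 1) * (c * \<rho>' / (16 * (C + 1)))"
      using C s(1) by (intro mult_mono) (auto simp: s_def)
    also have "\<dots> = c * \<rho>' / 16" using C by (simp add: field_simps)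
    finally show ?thesis by simp
  qed
  obtain w and \<zeta> :: "'z \<Rightarrow>\<^sub>L real" and r1 where w: "norm w < s" and r1: "r1 > 0"
    and sub: "\<And>h. norm h \<le> r1 \<Longrightarrow> m w + \<zeta> h - e / 2 * norm h \<le> m (w + h)"
    and slope: "\<And>h M. (\<And>w t. t > 0 \<Longrightarrow> norm w < s \<Longrightarrow> norm (w + t *\<^sub>R h) < s \<Longrightarrow>
       m (w + t *\<^sub>R h) - m w \<le> t * M) \<Longrightarrow> \<zeta> h \<le> M + e / 2 * norm h"
    using lipschitz_approx_subgradient[OF sm m_lip s(1), of "e / 2"] e by (metis half_gt_zero)
  define r2 where "r2 = min r1 (\<rho>' / 4)"
  have r2: "r2 > 0" "r2 \<le> r1" "r2 \<le> \<rho>' / 4" using r1 \<rho>' by (auto simp: r2_def)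
  \<comment> \<open>The three bounds keep \<open>v1\<close> near \<open>v\<close>, Ekeland's
    displacement \<open>2 * \<beta> / e\<close> at most \<open>r2 / 2\<close>, and the excess of
    \<open>T (v2 - w)\<close> over \<open>m w\<close> at most \<open>e * r2 / 2\<close>.\<close>
  define \<beta> where "\<beta> = min (c * \<rho>' / 8) (min (e * r2 / 4) (e * r2 / 2 / (1 + 2 * C / e)))"
  have den: "1 + 2 * C / e > 0" using C e by (intro add_pos_nonneg) auto
  have \<beta>: "\<beta> > 0" using c \<rho>' e r2 den by (simp add: \<beta>_def)
  have \<beta>1: "\<beta> \<le> c * \<rho>' / 8" and \<beta>2: "\<beta> \<le> e * r2 / 4"
    unfolding \<beta>_def by (rule min.cobounded1, rule min.coboundedI2, rule min.cobounded1)
  have \<beta>3: "\<beta> + C * (2 * \<beta> / e) \<le> e * r2 / 2"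
  proof -
    have "\<beta> \<le> e * r2 / 2 / (1 + 2 * C / e)" unfolding \<beta>_def by (intro min.coboundedI2 order_refl)
    then have "\<beta> * (1 + 2 * C / e) \<le> e * r2 / 2" using den by (simp only: pos_le_divide_eq)
    then show ?thesis by (simp add: algebra_simps)
  qed
  obtain v1 where v1: "v1 \<in> S" "T (v1 - w) < m w + \<beta>"
  proof -
    have "m w < m w + \<beta>" using \<beta> by simp
    then have "\<exists>u\<in>S. T (u - w) < m w + \<beta>"
      unfolding m_def using vS bdd by (subst (asm) cINF_less_iff) auto
    then show ?thesis using that by blast
  qed
  have v1v: "norm (v1 - v) \<le> \<rho>' / 4"
  proof -
    have Cw: "C * norm w \<le> C * s" using w C by (intro mult_left_mono) auto
    have "T v1 \<le> T (v1 - w) + C * s" using lip[of v1 "v1 - w"] Cw by (simp add: abs_le_iff)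
    moreover have "m w \<le> T v + C * s" using m_le[OF vS, of w] lip[of "v - w" v] Cw by (simp add: abs_le_iff)
    moreover have "T v + c * norm (v1 - v) \<le> T v1"
      using v1(1) by (intro min) (auto simp: S_def dist_norm norm_minus_commute)
    ultimately have "c * norm (v1 - v) \<le> c * (\<rho>' / 4)" using v1(2) Cs \<beta>1 by simp
    then show ?thesis using c by simp
  qed
  define S1 where "S1 = S \<inter> cball v1 r2"
  have "closed S1" using G(1) by (auto simp: S1_def S_def)
  moreover have v1S1: "v1 \<in> S1" using v1 r2 by (simp add: S1_def)
  \<comment> \<open>Since \<open>u - (w + (u - v1)) = v1 - w\<close>, the single value
    \<open>T (v1 - w)\<close> bounds \<open>m\<close> from above at all shifts
    \<open>w + (u - v1)\<close>. With the subgradient inequality this makes \<open>v1\<close> a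
    minimizer of \<open>f\<close> up to \<open>\<beta>\<close>; Ekeland's principle then yields
    \<open>v2\<close>, where \<open>\<zeta>\<close> is an \<open>e\<close>-normal.\<close>
  moreover define f where "f u = e / 2 * norm (u - v1) - \<zeta> (u - v1)" for u
  have "continuous_on S1 f" unfolding f_def by (intro continuous_intros)
  moreover have f_ge: "- \<beta> \<le> f u" if "u \<in> S1" for u
  proof -
    have "norm (u - v1) \<le> r1" using that r2 by (auto simp: S1_def dist_norm norm_minus_commute)
    then have "m w + \<zeta> (u - v1) - e / 2 * norm (u - v1) \<le> m (w + (u - v1))" by (rule sub)
    also have "\<dots> \<le> T (u - (w + (u - v1)))" using that by (intro m_le) (simp add: S1_def)
    also have "u - (w + (u - v1)) = v1 - w" by simp
    finally show ?thesis using v1(2) by (simp add: f_def)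
  qed
  ultimately obtain v2 where v2: "v2 \<in> S1" "f v2 + e / 2 * dist v1 v2 \<le> f v1"
    and v2min: "\<And>u. u \<in> S1 \<Longrightarrow> f v2 \<le> f u + e / 2 * dist u v2"
    using ekeland[of S1 v1 f "- \<beta>" "e / 2"] e by (metis half_gt_zero)
  have "e / 2 * dist v1 v2 \<le> \<beta>" using v2(2) f_ge[OF v2(1)] by (simp add: f_def)
  then have d12: "norm (v2 - v1) \<le> 2 * \<beta> / e"
    using e by (simp add: dist_norm norm_minus_commute field_simps)
  also have "2 * \<beta> / e \<le> r2 / 2" using \<beta>2 e by (simp add: field_simps)
  finally have d12': "norm (v2 - v1) \<le> r2 / 2" .
  have v2S: "v2 \<in> S" using v2 by (simp add: S1_def)
  have v2v: "norm (v2 - v) \<le> \<rho>' / 2"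
    using norm_triangle_ineq[of "v2 - v1" "v1 - v"] v1v d12' r2 by simp
  have Tv2: "T (v2 - w) \<le> m w + e * (r2 / 2)"
  proof -
    have "C * norm (v2 - v1) \<le> C * (2 * \<beta> / e)" using d12 C by (intro mult_left_mono)
    then show ?thesis using lip[of "v2 - w" "v1 - w"] v1(2) \<beta>3 by (simp add: abs_le_iff)
  qed
  show ?thesis
  proof (rule that[of v2 "r2 / 2" \<zeta>])
    show "v2 \<in> G" using v2S by (simp add: S_def)
    show "norm (v2 - v) \<le> \<rho>" using v2v \<rho>' by simp
    show "r2 / 2 > 0" using r2 by simp
    show "\<zeta> (u - v2) \<le> e * norm (u - v2)" if "u \<in> G" "norm (u - v2) \<le> r2 / 2" for u
    proof -
      have u1: "norm (u - v1) \<le> r2"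
        using norm_triangle_ineq[of "u - v2" "v2 - v1"] that(2) d12' by simp
      have "norm (u - v) \<le> r"
        using norm_triangle_ineq[of "u - v1" "v1 - v"] u1 v1v r2 \<rho>' by simp
      then have "u \<in> S1" using that u1 by (simp add: S1_def S_def dist_norm norm_minus_commute)
      then have "f v2 \<le> f u + e / 2 * norm (u - v2)" using v2min by (simp add: dist_norm)
      moreover have "e / 2 * norm (u - v1) \<le> e / 2 * norm (u - v2) + e / 2 * norm (v2 - v1)"
        using norm_triangle_ineq[of "u - v2" "v2 - v1"] e by (simp flip: distrib_left)
      moreover have "\<zeta> (u - v2) = \<zeta> (u - v1) - \<zeta> (v2 - v1)" by (simp flip: blinfun.diff_right)
      ultimately show ?thesis unfolding f_def by (simp add: field_simps)
    qed
    show "\<zeta> h \<le> M + e * norm h"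
      if M: "\<And>u t. t > 0 \<Longrightarrow> norm (u - v) < 2 * r \<Longrightarrow> norm (u - t *\<^sub>R h - v) < 2 * r \<Longrightarrow>
        T (u - t *\<^sub>R h) - T u \<le> t * M" for h M
    proof -
      have "\<zeta> h \<le> M + e / 2 * norm h"
      proof (rule slope)
        \<comment> \<open>\<open>m\<close> is an infimum of shifts of \<open>T\<close>, so its
          increments along \<open>h\<close> are bounded by those of \<open>T\<close> along
          \<open>- h\<close>. Because of \<open>s \<le> r\<close> all points involved lie within
          \<open>2 * r\<close> of \<open>v\<close>.\<close>
        fix w' t assume t: "t > 0" and w': "norm w' < s" "norm (w' + t *\<^sub>R h) < s"
        have "m (w' + t *\<^sub>R h) - t * M \<le> m w'"
        proof (rule m_ge)
          fix u assume u: "u \<in> S"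
          then have ur: "norm (u - v) \<le> r" by (simp add: S_def dist_norm norm_minus_commute)
          have "norm (u - w' - v) < 2 * r"
            using norm_triangle_ineq4[of "u - v" w'] ur w' s by (simp add: algebra_simps)
          moreover have "norm (u - w' - t *\<^sub>R h - v) < 2 * r"
            using norm_triangle_ineq4[of "u - v" "w' + t *\<^sub>R h"] ur w' s by (simp add: algebra_simps)
          ultimately have "T (u - w' - t *\<^sub>R h) - T (u - w') \<le> t * M" using t by (intro M)
          moreover have "m (w' + t *\<^sub>R h) \<le> T (u - w' - t *\<^sub>R h)"
            using m_le[OF u, of "w' + t *\<^sub>R h"] by (simp add: algebra_simps)
          ultimately show "m (w' + t *\<^sub>R h) - t * M \<le> T (u - w')" by simp
        qed
        then show "m (w' + t *\<^sub>R h) - m w' \<le> t * M" by simp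
      qed
      moreover have "e / 2 * norm h \<le> e * norm h" using e by (intro mult_right_mono) auto
      ultimately show ?thesis by simp
    qed
    show "\<exists>w. T (v2 - w) \<le> T (u - w) + e * norm (u - v2)"
      if u: "u \<in> G" "norm (u - v) \<le> r" "r2 / 2 \<le> norm (u - v2)" for u
    proof (intro exI)
      \<comment> \<open>The excess of \<open>T (v2 - w)\<close> over \<open>m w\<close> is at most
        \<open>e * (r2 / 2)\<close>, which the distance from \<open>u\<close> to \<open>v2\<close>
        absorbs.\<close>
      have "m w \<le> T (u - w)" using u by (intro m_le) (simp add: S_def dist_norm norm_minus_commute)
      moreover have "e * (r2 / 2) \<le> e * norm (u - v2)" using u(3) e by (intro mult_left_mono) auto
      ultimately show "T (v2 - w) \<le> T (u - w) + e * norm (u - v2)" using Tv2 by linarith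
    qed
  qed
qed

lemma norm_blinfun_le_of_upper:
  fixes z :: "'a::real_normed_vector \<Rightarrow>\<^sub>L real"
  assumes "\<And>h. z h \<le> b * norm h" "b \<ge> 0"
  shows "norm z \<le> b"
proof (rule norm_blinfun_bound[OF assms(2)])
  show "norm (z h) \<le> b * norm h" for h
    using assms(1)[of h] assms(1)[of "- h"] by (simp add: blinfun.minus_right abs_le_iff)
qed

text \<open>As \<open>z\<close> is an \<open>e\<close>-normal,
  \<open>T u = 2 * e * norm (u - v) - z u\<close> has a strong minimum at \<open>v\<close> with
  constant \<open>e\<close>. Its increments along \<open>- h\<close> exceed those of
  \<open>z h\<close> by at most \<open>2 * e * norm h\<close> per unit step, which keeps
  \<open>z'\<close> near \<open>z\<close>. The last conclusion controls the old functional from the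
  new base point on the whole old ball, also at scales above \<open>r'\<close>, where nothing is
  known about \<open>z'\<close>.\<close>

lemma approx_normal_refine:
  fixes G :: "'z::banach set" and z :: "'z \<Rightarrow>\<^sub>L real"
  assumes sm: "approx_smooth TYPE('z)"
    and G: "closed (G \<inter> cball v r)" "v \<in> G" and r: "r > 0" and e: "e > 0"
    and nor: "\<And>u. u \<in> G \<Longrightarrow> norm (u - v) \<le> r \<Longrightarrow> z (u - v) \<le> e * norm (u - v)"
    and \<rho>: "\<rho> > 0"
  obtains v' and z' :: "'z \<Rightarrow>\<^sub>L real" and r' where "v' \<in> G" "norm (v' - v) \<le> \<rho>" "r' > 0" "r' \<le> r / 2"
    "closed (G \<inter> cball v' r')"
    "\<And>u. u \<in> G \<Longrightarrow> norm (u - v') \<le> r' \<Longrightarrow> z' (u - v') \<le> e / 2 * norm (u - v')"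
    "norm (z' - z) \<le> 3 * e"
    "\<And>u. u \<in> G \<Longrightarrow> norm (u - v) \<le> r \<Longrightarrow> z (u - v') \<le> 4 * e * norm (u - v')"
proof -
  define T where "T u = 2 * e * norm (u - v) - z u" for u
  have lip: "\<bar>T a - T b\<bar> \<le> (2 * e + norm z) * norm (a - b)" for a b
  proof -
    have "\<bar>z a - z b\<bar> \<le> norm z * norm (a - b)"
      using norm_blinfun[of z "a - b"] by (simp add: blinfun.diff_right)
    moreover have "\<bar>norm (a - v) - norm (b - v)\<bar> \<le> norm (a - b)"
      using norm_triangle_ineq3[of "a - v" "b - v"] by simp
    then have "2 * e * \<bar>norm (a - v) - norm (b - v)\<bar> \<le> 2 * e * norm (a - b)"
      using e by (intro mult_left_mono) auto
    then have "\<bar>2 * e * norm (a - v) - 2 * e * norm (b - v)\<bar> \<le> 2 * e * norm (a - b)"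
      using e by (simp add: abs_mult flip: right_diff_distrib)
    ultimately show ?thesis unfolding T_def by (simp add: abs_le_iff distrib_right)
  qed
  have tmin: "T v + e * norm (u - v) \<le> T u" if "u \<in> G" "norm (u - v) \<le> r" for u
    using nor[OF that] by (simp add: T_def blinfun.diff_right algebra_simps)
  obtain v' and z' :: "'z \<Rightarrow>\<^sub>L real" and r1 where v': "v' \<in> G" "norm (v' - v) \<le> min \<rho> (r / 2)" and r1: "r1 > 0"
    and nor': "\<And>u. u \<in> G \<Longrightarrow> norm (u - v') \<le> r1 \<Longrightarrow> z' (u - v') \<le> e / 2 * norm (u - v')"
    and slope: "\<And>h M. (\<And>u t. t > 0 \<Longrightarrow> norm (u - v) < 2 * r \<Longrightarrow> norm (u - t *\<^sub>R h - v) < 2 * r \<Longrightarrow>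
        T (u - t *\<^sub>R h) - T u \<le> t * M) \<Longrightarrow> z' h \<le> M + e / 2 * norm h"
    and far: "\<And>u. u \<in> G \<Longrightarrow> norm (u - v) \<le> r \<Longrightarrow> r1 \<le> norm (u - v') \<Longrightarrow>
        \<exists>w. T (v' - w) \<le> T (u - w) + e / 2 * norm (u - v')"
    by (rule approx_normal_near_strong_min[OF sm G r lip _ e tmin, of "min \<rho> (r / 2)" "e / 2"])
      (use e r \<rho> in auto)
  have "z' h \<le> z h + 2 * e * norm h + e / 2 * norm h" for h
  proof (rule slope)
    fix u and t :: real assume "t > 0"
    have "norm (u - t *\<^sub>R h - v) \<le> norm (u - v) + t * norm h"
      using norm_triangle_ineq4[of "u - v" "t *\<^sub>R h"] \<open>t > 0\<close> by (simp add: algebra_simps)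
    then have "2 * e * norm (u - t *\<^sub>R h - v) \<le> 2 * e * (norm (u - v) + t * norm h)"
      using e by (intro mult_left_mono) auto
    then show "T (u - t *\<^sub>R h) - T u \<le> t * (z h + 2 * e * norm h)"
      by (simp add: T_def blinfun.diff_right blinfun.scaleR_right algebra_simps)
  qed
  then have zz: "(z' - z) h \<le> 5 / 2 * e * norm h" for h
    by (simp add: blinfun.diff_left algebra_simps) (smt (verit) field_sum_of_halves)
  then have "norm (z' - z) \<le> 5 / 2 * e" using e by (intro norm_blinfun_le_of_upper) auto
  then have nzz: "norm (z' - z) \<le> 3 * e" using e by simp
  have zz': "z h \<le> z' h + 5 / 2 * e * norm h" for h
    using zz[of "- h"] by (simp add: blinfun.diff_left blinfun.minus_right)
  define r' where "r' = min r1 (r / 2)"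
  have "cball v' r' \<subseteq> cball v r"
  proof
    fix u assume "u \<in> cball v' r'"
    then show "u \<in> cball v r"
      using v'(2) dist_triangle[of v u v'] by (simp add: r'_def dist_norm norm_minus_commute)
  qed
  then have "G \<inter> cball v' r' = (G \<inter> cball v r) \<inter> cball v' r'" by blast
  then have cl: "closed (G \<inter> cball v' r')" using G(1) by (metis closed_Int closed_cball)
  show ?thesis
  proof (rule that[of v' r' z'])
    show "z (u - v') \<le> 4 * e * norm (u - v')" if u: "u \<in> G" "norm (u - v) \<le> r" for u
    \<comment> \<open>Within \<open>r1\<close> the new normal applies, and \<open>z\<close> exceeds
      \<open>z'\<close> by a rate of at most \<open>5 / 2 * e\<close>. Beyond, \<open>v'\<close> is
      almost minimal after some shift \<open>w\<close>: in the linear part of \<open>T\<close> the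
      shift cancels, and the norm part costs at most \<open>2 * e * norm (u - v')\<close>.\<close>
    proof (cases "norm (u - v') \<le> r1")
      case True
      have "z (u - v') \<le> e / 2 * norm (u - v') + 5 / 2 * e * norm (u - v')"
        using nor'[OF u(1) True] zz'[of "u - v'"] by linarith
      also have "\<dots> \<le> 4 * e * norm (u - v')" using e by (simp add: algebra_simps)
      finally show ?thesis .
    next
      case False
      then obtain w where w: "T (v' - w) \<le> T (u - w) + e / 2 * norm (u - v')"
        using far[OF u] by auto
      have "norm (u - w - v) \<le> norm (v' - w - v) + norm (u - v')"
        using norm_triangle_ineq[of "v' - w - v" "u - v'"] by (simp add: algebra_simps)
      then have "2 * e * norm (u - w - v) \<le> 2 * e * (norm (v' - w - v) + norm (u - v'))"
        using e by (intro mult_left_mono) auto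
      then have "z (u - v') \<le> 2 * e * norm (u - v') + e / 2 * norm (u - v')"
        using w by (simp add: T_def blinfun.diff_right algebra_simps)
      also have "\<dots> \<le> 4 * e * norm (u - v')" using e by (simp add: algebra_simps)
      finally show ?thesis .
    qed
  qed (use v' r1 r nor' nzz cl in \<open>auto simp: r'_def\<close>)
qed

text \<open>Halving the errors makes the functionals converge. Each move of the base point is small
  against the current radius, so at comparable distances the limit point can replace it. At
  distances between \<open>R (Suc j) / 2\<close> and \<open>R j / 2\<close> from the limit the
  functional \<open>Z j\<close> gives the estimate, and these ranges cover all small scales.\<close>

lemma prenormal_near_strong_min:
  fixes G :: "'z::banach set" and T :: "'z \<Rightarrow> real"
  assumes sm: "approx_smooth TYPE('z)"
    and G: "closed (G \<inter> cball v r)" "v \<in> G" and r: "r > 0"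
    and lip: "\<And>a b. \<bar>T a - T b\<bar> \<le> C * norm (a - b)" and C: "C \<ge> 0"
    and c: "c > 0" and min: "\<And>u. u \<in> G \<Longrightarrow> norm (u - v) \<le> r \<Longrightarrow> T v + c * norm (u - v) \<le> T u"
    and \<rho>: "\<rho> > 0" and e: "e > 0"
  obtains v' and \<zeta> :: "'z \<Rightarrow>\<^sub>L real" where "v' \<in> G" "norm (v' - v) \<le> \<rho>" "\<zeta> \<in> prenormal_cone v' G"
    "\<And>h M. (\<And>u t. t > 0 \<Longrightarrow> norm (u - v) < 2 * r \<Longrightarrow> norm (u - t *\<^sub>R h - v) < 2 * r \<Longrightarrow>
        T (u - t *\<^sub>R h) - T u \<le> t * M) \<Longrightarrow> \<zeta> h \<le> M + e * norm h"
proof -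
  \<comment> \<open>\<open>7 * e0\<close> is the error \<open>e0\<close> of the first functional
    plus the bound \<open>6 * e0\<close> on its distance from the limit.\<close>
  define e0 where "e0 = min 1 (e / 7)"
  have e0: "e0 > 0" "e0 \<le> 1" "7 * e0 \<le> e" using e by (auto simp: e0_def)
  define E where "E n = e0 * (1/2) ^ n" for n
  have E: "E n > 0" "E n \<le> 1" "E (Suc n) = E n / 2" for n
    using e0 mult_mono[of e0 1 "(1/2) ^ n" 1] by (auto simp: E_def power_le_one)
  have E_mono: "E j \<le> E n" if "n \<le> j" for n j
    using e0 that unfolding E_def by (intro mult_left_mono power_decreasing) auto
  define P where "P n s \<longleftrightarrow> (case s of (a, z :: 'z \<Rightarrow>\<^sub>L real, q) \<Rightarrow> a \<in> G \<and> q > 0 \<and> closed (G \<inter> cball a q) \<and>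
      (\<forall>u\<in>G. norm (u - a) \<le> q \<longrightarrow> z (u - a) \<le> E n * norm (u - a)))" for n s
  \<comment> \<open>The estimate of the old functional from the new base point relates two
    consecutive states, so it is kept in \<open>Q\<close> and not in the invariant
    \<open>P\<close>.\<close>
  define Q where "Q n s s' \<longleftrightarrow> (case s of (a, z :: 'z \<Rightarrow>\<^sub>L real, q) \<Rightarrow> case s' of (a', z' :: 'z \<Rightarrow>\<^sub>L real, q') \<Rightarrow>
      norm (a' - a) \<le> E n * q / 4 \<and> q' \<le> q / 2 \<and> norm (z' - z) \<le> 3 * E n \<and>
      (\<forall>u\<in>G. norm (u - a) \<le> q \<longrightarrow> z (u - a') \<le> 4 * E n * norm (u - a')))" for n s s'
  obtain v0 and \<zeta>0 :: "'z \<Rightarrow>\<^sub>L real" and r1 where v0: "v0 \<in> G" "norm (v0 - v) \<le> min (\<rho> / 2) (r / 2)" and r1: "r1 > 0"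
    and nor0: "\<And>u. u \<in> G \<Longrightarrow> norm (u - v0) \<le> r1 \<Longrightarrow> \<zeta>0 (u - v0) \<le> e0 * norm (u - v0)"
    and slope: "\<And>h M. (\<And>u t. t > 0 \<Longrightarrow> norm (u - v) < 2 * r \<Longrightarrow> norm (u - t *\<^sub>R h - v) < 2 * r \<Longrightarrow>
        T (u - t *\<^sub>R h) - T u \<le> t * M) \<Longrightarrow> \<zeta>0 h \<le> M + e0 * norm h"
    by (rule approx_normal_near_strong_min[OF sm G r lip C c min, of "min (\<rho> / 2) (r / 2)" e0])
      (use e0 r \<rho> in auto)
  define r0 where "r0 = min r1 (min (r / 2) \<rho>)"
  have r0: "r0 > 0" "r0 \<le> \<rho>" using r1 r \<rho> by (auto simp: r0_def)
  have P0: "P 0 (v0, \<zeta>0, r0)"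
  proof -
    have "cball v0 r0 \<subseteq> cball v r"
    proof
      fix u assume "u \<in> cball v0 r0"
      then show "u \<in> cball v r"
        using v0(2) dist_triangle[of v u v0] by (simp add: r0_def dist_norm norm_minus_commute)
    qed
    then have "G \<inter> cball v0 r0 = (G \<inter> cball v r) \<inter> cball v0 r0" by blast
    then have "closed (G \<inter> cball v0 r0)" using G(1) by (metis closed_Int closed_cball)
    then show ?thesis using v0(1) r0 nor0 by (simp add: P_def E_def r0_def)
  qed
  have step: "\<exists>s'. P (Suc n) s' \<and> Q n s s'" if "P n s" for n s
  proof -
    obtain a q and z :: "'z \<Rightarrow>\<^sub>L real" where s: "s = (a, z, q)" using prod_cases3 by blast
    have aq: "a \<in> G" "q > 0" "closed (G \<inter> cball a q)"
      "\<And>u. u \<in> G \<Longrightarrow> norm (u - a) \<le> q \<Longrightarrow> z (u - a) \<le> E n * norm (u - a)"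
      using \<open>P n s\<close> by (auto simp: P_def s)
    have "E n * q / 4 > 0" using E aq by simp
    show ?thesis
    proof (rule approx_normal_refine[OF sm aq(3,1,2) E(1) aq(4) \<open>E n * q / 4 > 0\<close>])
      fix a' q' and z' :: "'z \<Rightarrow>\<^sub>L real"
      assume "a' \<in> G" "norm (a' - a) \<le> E n * q / 4" "q' > 0" "q' \<le> q / 2"
        "closed (G \<inter> cball a' q')"
        "\<And>u. u \<in> G \<Longrightarrow> norm (u - a') \<le> q' \<Longrightarrow> z' (u - a') \<le> E n / 2 * norm (u - a')"
        "norm (z' - z) \<le> 3 * E n"
        "\<And>u. u \<in> G \<Longrightarrow> norm (u - a) \<le> q \<Longrightarrow> z (u - a') \<le> 4 * E n * norm (u - a')"
      then have "P (Suc n) (a', z', q') \<and> Q n s (a', z', q')"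
        by (simp add: P_def Q_def s E(3))
      then show ?thesis by blast
    qed
  qed
  obtain S where S0: "S 0 = (v0, \<zeta>0, r0)" and SP: "\<And>n. P n (S n)" and SQ: "\<And>n. Q n (S n) (S (Suc n))"
  proof -
    have "\<exists>S. \<forall>n. (P n (S n) \<and> (n = 0 \<longrightarrow> S n = (v0, \<zeta>0, r0))) \<and> Q n (S n) (S (Suc n))"
      using P0 step by (intro dependent_nat_choice) auto
    then show ?thesis using that by blast
  qed
  define V where "V n = fst (S n)" for n
  define Z where "Z n = fst (snd (S n))" for n
  define R where "R n = snd (snd (S n))" for n
  have S: "S n = (V n, Z n, R n)" for n by (simp add: V_def Z_def R_def)
  have VG: "V n \<in> G" and R: "R n > 0" and cl: "closed (G \<inter> cball (V n) (R n))" for n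
    using SP[of n] by (auto simp: P_def S)
  have Vstep: "norm (V (Suc n) - V n) \<le> E n * R n / 4" and Rstep: "R (Suc n) \<le> R n / 2"
    and Zstep: "norm (Z (Suc n) - Z n) \<le> 3 * E n"
    and keep: "\<And>u. u \<in> G \<Longrightarrow> norm (u - V n) \<le> R n \<Longrightarrow> Z n (u - V (Suc n)) \<le> 4 * E n * norm (u - V (Suc n))" for n
    using SQ[of n] by (auto simp: Q_def S)
  have R_mono: "R j \<le> R n" if "n \<le> j" for n j
    using that by (rule lift_Suc_antimono_le[rotated]) (use Rstep R in \<open>smt (verit) field_sum_of_halves\<close>)
  have "E (Suc n) * R (Suc n) / 4 \<le> E n * R n / 4 / 2" for n
    using mult_left_mono[of "R (Suc n)" "R n" "E n"] E[of n] Rstep[of n] R[of n] by (simp add: E(3))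
  from geometric_steps_limit[of V "\<lambda>n. E n * R n / 4", OF Vstep this]
  obtain a where Va: "V \<longlonglongrightarrow> a" and a2: "\<And>n. norm (a - V n) \<le> 2 * (E n * R n / 4)" by blast
  have a: "norm (a - V n) \<le> E n * R n / 2" for n using a2[of n] by simp
  have a_R: "norm (a - V n) \<le> R n / 2" for n
    using a[of n] mult_left_le_one_le[OF less_imp_le[OF R[of n]] less_imp_le[OF E(1)] E(2)[of n]] by simp
  have "3 * E (Suc n) \<le> 3 * E n / 2" for n by (simp add: E)
  from geometric_steps_limit[of Z "\<lambda>n. 3 * E n", OF Zstep this]
  obtain \<zeta> where z6: "\<And>n. norm (\<zeta> - Z n) \<le> 2 * (3 * E n)" by blast
  have V0: "V 0 = v0" "Z 0 = \<zeta>0" "R 0 = r0" using S0 by (auto simp: V_def Z_def R_def)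
  have "a \<in> G \<inter> cball (V 0) (R 0)"
  proof (rule closed_sequentially[OF cl _ Va])
    fix n
    have "norm (V n - V 0) \<le> norm (a - V n) + norm (a - V 0)"
      using norm_triangle_ineq4[of "a - V 0" "a - V n"] by simp
    also have "\<dots> \<le> R n / 2 + R 0 / 2" using a_R by (intro add_mono)
    also have "\<dots> \<le> R 0" using R_mono[of 0 n] by simp
    finally show "V n \<in> G \<inter> cball (V 0) (R 0)"
      using VG by (simp add: dist_norm norm_minus_commute)
  qed
  then have aG: "a \<in> G" by simp
  have av: "norm (a - v) \<le> \<rho>"
    using norm_triangle_ineq[of "a - v0" "v0 - v"] a_R[of 0] v0(2) r0 by (simp add: V0)
  have R_lim: "\<exists>k. R k / 2 < d" if d: "d > 0" for d
  proof -
    have geo: "R k \<le> R 0 * (1/2) ^ k" for k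
      by (induction k) (use Rstep in \<open>auto intro: order_trans\<close>)
    obtain k where "(1/2::real) ^ k < d / R 0"
      using real_arch_pow_inv[of "d / R 0" "1/2"] d R[of 0] by auto
    then have "R 0 * (1/2) ^ k < d" using R[of 0] by (simp add: pos_less_divide_eq mult.commute)
    then have "R k / 2 < d" using geo[of k] R[of k] by simp
    then show ?thesis ..
  qed
  have nor: "\<zeta> (u - a) \<le> (20 + norm \<zeta>) * E n * norm (u - a)"
    if u: "u \<in> G" "norm (u - a) \<le> R n / 2" for u n
  proof (cases "u = a")
    case False
    define d where "d = norm (u - a)"
    have d: "d > 0" using False by (simp add: d_def)
    \<comment> \<open>\<open>k\<close> is the first index whose half radius falls below
      \<open>d\<close>. With \<open>k = Suc j\<close> this gives \<open>d \<le> R j / 2\<close>, so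
      the estimate kept from step \<open>j\<close> applies to \<open>u\<close>, while
      \<open>V k\<close> is within \<open>E j * d\<close> of \<open>a\<close>.\<close>
    define k where "k = (LEAST k. R k / 2 < d)"
    have k: "R k / 2 < d" unfolding k_def using R_lim[OF d] by (rule LeastI_ex)
    have "\<not> k \<le> n" using k u(2) R_mono[of k n] by (auto simp: d_def)
    then obtain j where j: "k = Suc j" "n \<le> j" by (metis Suc_le_D not_less_eq_eq)
    have dj: "d \<le> R j / 2" using not_less_Least[of j "\<lambda>k. R k / 2 < d", folded k_def] by (simp add: j(1))
    define b where "b = norm (a - V k)"
    have "b \<le> E k * (R k / 2)" using a[of k] by (simp add: b_def)
    also have "\<dots> \<le> E j * d"
      using E[of k] E_mono[of j k] k j(1) R[of k] d by (intro mult_mono) auto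
    finally have bE: "b \<le> E j * d" .
    have bd: "b \<le> d" using bE mult_left_le_one_le[OF less_imp_le[OF d] less_imp_le[OF E(1)] E(2)[of j]] by simp
    have "norm (u - V j) \<le> R j"
      using norm_triangle_ineq[of "u - a" "a - V j"] dj a_R[of j] by (simp add: d_def)
    from keep[OF u(1) this] have "Z j (u - V k) \<le> 4 * E j * norm (u - V k)" by (simp add: j)
    also have "\<dots> \<le> 4 * E j * (2 * d)"
      using norm_triangle_ineq[of "u - a" "a - V k"] bd E[of j]
      by (intro mult_left_mono) (auto simp: d_def b_def)
    finally have "Z j (u - V k) \<le> 8 * E j * d" by simp
    moreover have "Z j (V k - a) \<le> (norm \<zeta> + 6) * (E j * d)"
    proof -
      have "norm (Z j) \<le> norm \<zeta> + 6"
        using norm_triangle_ineq4[of \<zeta> "\<zeta> - Z j"] z6[of j] E[of j] by simp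
      then have "norm (Z j) * norm (V k - a) \<le> (norm \<zeta> + 6) * (E j * d)"
        using bE by (intro mult_mono) (auto simp: b_def norm_minus_commute)
      then show ?thesis using norm_blinfun[of "Z j" "V k - a"] by simp
    qed
    moreover have "(\<zeta> - Z j) (u - a) \<le> 6 * E j * d"
    proof -
      have "norm (\<zeta> - Z j) * d \<le> 6 * E j * d" using z6[of j] d by (intro mult_right_mono) auto
      then show ?thesis using norm_blinfun[of "\<zeta> - Z j" "u - a"] by (simp add: d_def)
    qed
    moreover have "\<zeta> (u - a) = Z j (u - V k) + Z j (V k - a) + (\<zeta> - Z j) (u - a)"
      by (simp add: blinfun.diff_left blinfun.diff_right)
    ultimately have "\<zeta> (u - a) \<le> (20 + norm \<zeta>) * E j * d" by (simp add: algebra_simps)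
    also have "\<dots> \<le> (20 + norm \<zeta>) * E n * d"
      using E_mono[OF j(2)] d by (intro mult_right_mono mult_left_mono) auto
    finally show ?thesis by (simp add: d_def)
  qed simp
  have "\<zeta> \<in> prenormal_cone a G"
  proof (rule prenormal_coneI)
    fix \<epsilon> :: real assume \<epsilon>: "\<epsilon> > 0"
    define K where "K = 20 + norm \<zeta>"
    have K: "K > 0" by (simp add: K_def add_pos_nonneg)
    obtain n where "(1/2::real) ^ n < \<epsilon> / K"
      using real_arch_pow_inv[of "\<epsilon> / K" "1/2"] \<epsilon> K by auto
    then have "K * (1/2) ^ n < \<epsilon>" using K by (simp add: pos_less_divide_eq mult.commute)
    moreover have "K * E n \<le> K * (1/2) ^ n"
      using K e0 by (intro mult_left_mono) (auto simp: E_def intro: mult_left_le_one_le)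
    ultimately have "K * E n \<le> \<epsilon>" by simp
    then have "\<zeta> (u - a) \<le> \<epsilon> * norm (u - a)" if "u \<in> G" "norm (u - a) < R n / 2" for u
      using nor[of u n] that mult_right_mono[of "K * E n" \<epsilon> "norm (u - a)"] by (simp add: K_def)
    then show "\<exists>d>0. \<forall>u\<in>G. norm (u - a) < d \<longrightarrow> \<zeta> (u - a) \<le> \<epsilon> * norm (u - a)"
      using R[of n] by (intro exI[of _ "R n / 2"]) auto
  qed
  moreover have "\<zeta> h \<le> M + e * norm h"
    if M: "\<And>u t. t > 0 \<Longrightarrow> norm (u - v) < 2 * r \<Longrightarrow> norm (u - t *\<^sub>R h - v) < 2 * r \<Longrightarrow>
        T (u - t *\<^sub>R h) - T u \<le> t * M" for h M
  proof -
    have "(\<zeta> - \<zeta>0) h \<le> 6 * e0 * norm h"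
    proof -
      have "norm (\<zeta> - \<zeta>0) * norm h \<le> 6 * e0 * norm h"
        using z6[of 0] by (intro mult_right_mono) (auto simp: V0 E_def)
      then show ?thesis using norm_blinfun[of "\<zeta> - \<zeta>0" h] by simp
    qed
    moreover have "\<zeta>0 h \<le> M + e0 * norm h" by (rule slope) (rule M)
    moreover have "7 * e0 * norm h \<le> e * norm h" using e0 by (intro mult_right_mono) auto
    ultimately show ?thesis by (simp add: blinfun.diff_left)
  qed
  ultimately show ?thesis using that aG av by blast
qed

subsection \<open>Solvability of the generalized equation\<close>

text \<open>The multiples of \<open>k\<close> are the losses along the way. The tilt of
  \<open>T\<close> costs \<open>2 * k\<close> and the passage to an exact normal costs
  \<open>k\<close>, so the \<open>x\<close>-part of the normal has norm at most
  \<open>l + 3 * k\<close>. The variation of \<open>y\<close> costs one more \<open>k\<close>, which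
  leaves at least \<open>1 - 4 * k\<close> for the \<open>y\<close>-part. The quotient of the two is
  below \<open>\<alpha>\<close>, against \<open>cov\<close>.\<close>

lemma generalized_equation_solvable:
  fixes F :: "'x::banach \<Rightarrow> 'y::banach set" and h :: "'x \<Rightarrow> 'y"
  assumes asp: "asplund TYPE('x)" "asplund TYPE('y)"
    and G: "closed (gph F \<inter> cball (xb, yb) R)" "yb \<in> F xb"
    and lip: "\<And>x x'. norm (x - xb) \<le> R \<Longrightarrow> norm (x' - xb) \<le> R \<Longrightarrow> norm (h x - h x') \<le> l * norm (x - x')"
    and l: "l \<ge> 0" and k: "k > 0" "4 * k < 1" "l + 3 * k < \<alpha> * (1 - 4 * k)"
    and cov: "\<And>x y xs ys. xs \<in> precoderivative F x y ys \<Longrightarrow> y \<in> F x \<Longrightarrow>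
        norm ((x, y) - (xb, yb)) \<le> R \<Longrightarrow> norm ys = 1 \<Longrightarrow> \<alpha> \<le> norm xs"
    and small: "norm (yb - h xb) < k * R"
  obtains x where "h x \<in> F x" "norm (x - xb) \<le> norm (yb - h xb) / k"
proof -
  define zb where "zb = (xb, yb)"
  define S where "S = gph F \<inter> cball zb R"
  have "k * R > 0" using small norm_ge_zero le_less_trans by blast
  then have R: "R > 0" using k by (simp add: zero_less_mult_iff)
  have fst_le: "norm (fst z - xb) \<le> norm (z - zb)" for z
    using norm_fst_le[of "fst z - xb" "snd z - yb"] by (cases z) (simp add: zb_def)
  define f where "f z = norm (snd z - h (fst z))" for z
  have "l-lipschitz_on (cball xb R) h"
    using lip l by (intro lipschitz_onI) (auto simp: dist_norm norm_minus_commute)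
  then have "continuous_on (cball xb R) h" by (rule lipschitz_on_continuous_on)
  moreover have "fst u \<in> cball xb R" if "u \<in> S" for u
    using fst_le[of u] that by (simp add: S_def dist_norm norm_minus_commute)
  then have "fst ` S \<subseteq> cball xb R" by blast
  ultimately have "continuous_on S (\<lambda>z. h (fst z))"
    by (intro continuous_on_compose2[OF _ continuous_on_fst[OF continuous_on_id]])
  then have "continuous_on S f" unfolding f_def by (intro continuous_intros)
  moreover have "zb \<in> S" using G R by (simp add: S_def zb_def gph_def)
  moreover have "closed S" using G by (simp add: S_def zb_def)
  moreover have "\<And>u. u \<in> S \<Longrightarrow> 0 \<le> f u" by (simp add: f_def)
  ultimately obtain zh where zh: "zh \<in> S" "f zh + k * dist zb zh \<le> f zb"
    and zmin: "\<And>u. u \<in> S \<Longrightarrow> f zh \<le> f u + k * dist u zh"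
    using ekeland[of S zb f 0 k] k(1) by metis
  define xh yh where "xh = fst zh" and "yh = snd zh"
  have zh_eq: "zh = (xh, yh)" by (simp add: xh_def yh_def)
  have "k * dist zb zh \<le> norm (yb - h xb)" 
  proof -
    have "0 \<le> f zh" "f zb = norm (yb - h xb)" by (auto simp: f_def zb_def)
    then show ?thesis using zh(2) by linarith
  qed
  then have zhd: "norm (zh - zb) \<le> norm (yb - h xb) / k"
    using k by (simp add: dist_norm norm_minus_commute field_simps)
  also have "\<dots> < R" using small k by (simp add: divide_less_eq mult.commute)
  finally have zhR: "norm (zh - zb) < R" .
  have "yh = h xh"
  proof (rule ccontr)
    assume ne: "yh \<noteq> h xh"
    define d where "d = yh - h xh"
    have d: "norm d > 0" using ne by (simp add: d_def)
    \<comment> \<open>The first bound keeps the ball around \<open>zh\<close> inside the region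
      covered by the hypotheses; the second makes the variation of \<open>y\<close> in it small
      against \<open>norm d\<close>.\<close>
    define r where "r = min (R - norm (zh - zb)) (k * norm d / 4)"
    have r: "r > 0" using zhR d k by (simp add: r_def)
    have "r \<le> k * norm d / 4" unfolding r_def by (rule min.cobounded2)
    then have r4: "4 * r \<le> k * norm d" by simp
    have in_R: "norm (u - zb) \<le> R" if "norm (u - zh) \<le> r" for u
      using norm_triangle_ineq[of "u - zh" "zh - zb"] that by (simp add: r_def)
    \<comment> \<open>\<open>h\<close> is replaced by its value at \<open>xh\<close>, at the cost \<open>l * norm (x - xh)\<close>; another \<open>k * norm (z - zh)\<close>
      makes the minimum strong.\<close>
    define T where "T z = norm (snd z - h xh) + l * norm (fst z - xh) + 2 * k * norm (z - zh)" for z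
    have cl: "closed (gph F \<inter> cball zh r)"
    proof -
      have "gph F \<inter> cball zh r = S \<inter> cball zh r"
        using in_R by (auto simp: S_def dist_norm norm_minus_commute)
      then show ?thesis using \<open>closed S\<close> by auto
    qed
    have Tlip: "\<bar>T a - T b\<bar> \<le> (1 + l + 2 * k) * norm (a - b)" for a b
    proof -
      have "norm (snd a - snd b) \<le> norm (a - b)" "norm (fst a - fst b) \<le> norm (a - b)"
        using norm_fst_le[of "fst a - fst b" "snd a - snd b"] norm_snd_le[of "snd a - snd b" "fst a - fst b"]
        by (simp_all add: minus_prod_def)
      then have 1: "\<bar>norm (snd a - h xh) - norm (snd b - h xh)\<bar> \<le> norm (a - b)"
        and 2: "\<bar>norm (fst a - xh) - norm (fst b - xh)\<bar> \<le> norm (a - b)"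
        and 3: "\<bar>norm (a - zh) - norm (b - zh)\<bar> \<le> norm (a - b)"
        using norm_triangle_ineq3[of "snd a - h xh" "snd b - h xh"]
          norm_triangle_ineq3[of "fst a - xh" "fst b - xh"] norm_triangle_ineq3[of "a - zh" "b - zh"]
        by auto
      have "T a - T b = (norm (snd a - h xh) - norm (snd b - h xh))
          + l * (norm (fst a - xh) - norm (fst b - xh)) + 2 * k * (norm (a - zh) - norm (b - zh))"
        by (simp add: T_def algebra_simps)
      also have "\<bar>\<dots>\<bar> \<le> \<bar>norm (snd a - h xh) - norm (snd b - h xh)\<bar>
          + \<bar>l * (norm (fst a - xh) - norm (fst b - xh))\<bar> + \<bar>2 * k * (norm (a - zh) - norm (b - zh))\<bar>"
        by (intro order_trans[OF abs_triangle_ineq] add_mono order_refl)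
      also have "\<dots> \<le> norm (a - b) + l * norm (a - b) + 2 * k * norm (a - b)"
        unfolding abs_mult using 1 2 3 l k by (intro add_mono mult_mono) auto
      finally show ?thesis by (simp add: algebra_simps)
    qed
    have Tmin: "T zh + k * norm (u - zh) \<le> T u" if u: "u \<in> gph F" "norm (u - zh) \<le> r" for u
    proof -
      have uS: "u \<in> S" using u in_R[OF u(2)] by (simp add: S_def dist_norm norm_minus_commute)
      have "norm (h (fst u) - h xh) \<le> l * norm (fst u - xh)"
        using fst_le[of u] fst_le[of zh] in_R[OF u(2)] zhR by (intro lip) (auto simp: xh_def)
      then have "f u \<le> norm (snd u - h xh) + l * norm (fst u - xh)"
        using norm_triangle_ineq4[of "snd u - h xh" "h (fst u) - h xh"] by (simp add: f_def)
      moreover have "f zh = T zh" by (simp add: f_def T_def zh_eq)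
      ultimately show ?thesis using zmin[OF uS] by (simp add: T_def dist_norm)
    qed
    have zhG: "zh \<in> gph F" using zh by (simp add: S_def)
    obtain v \<zeta> where v: "v \<in> gph F" "norm (v - zh) \<le> r" and \<zeta>: "\<zeta> \<in> prenormal_cone v (gph F)"
      and slope: "\<And>q M. (\<And>u t. t > 0 \<Longrightarrow> norm (u - zh) < 2 * r \<Longrightarrow> norm (u - t *\<^sub>R q - zh) < 2 * r \<Longrightarrow>
        T (u - t *\<^sub>R q) - T u \<le> t * M) \<Longrightarrow> \<zeta> q \<le> M + k * norm q"
      by (rule prenormal_near_strong_min[OF approx_smooth_prod[OF asp] cl zhG r Tlip _ k(1) Tmin r k(1)])
        (use l k in auto)
    define \<xi> where "\<xi> = Blinfun (\<lambda>x. \<zeta> (x, 0))"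
    define \<upsilon> where "\<upsilon> = Blinfun (\<lambda>y. \<zeta> (0, y))"
    have "bounded_linear (\<lambda>x. \<zeta> (x, 0))"
      by (rule bounded_linear_compose[OF blinfun.bounded_linear_right])
        (intro bounded_linear_Pair bounded_linear_ident bounded_linear_zero)
    then have \<xi>: "\<xi> x = \<zeta> (x, 0)" for x by (simp add: \<xi>_def bounded_linear_Blinfun_apply)
    have "bounded_linear (\<lambda>y. \<zeta> (0, y))"
      by (rule bounded_linear_compose[OF blinfun.bounded_linear_right])
        (intro bounded_linear_Pair bounded_linear_ident bounded_linear_zero)
    then have \<upsilon>: "\<upsilon> y = \<zeta> (0, y)" for y by (simp add: \<upsilon>_def bounded_linear_Blinfun_apply)
    have T2: "2 * k * norm (u - t *\<^sub>R q - zh) \<le> 2 * k * norm (u - zh) + t * (2 * k * norm q)"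
      if "t > 0" for u q t
    proof -
      have "norm (u - t *\<^sub>R q - zh) \<le> norm (u - zh) + t * norm q"
        using norm_triangle_ineq4[of "u - zh" "t *\<^sub>R q"] \<open>t > 0\<close> by (simp add: algebra_simps)
      then have "2 * k * norm (u - t *\<^sub>R q - zh) \<le> 2 * k * (norm (u - zh) + t * norm q)"
        using k by (intro mult_left_mono) auto
      then show ?thesis by (simp add: algebra_simps)
    qed
    have \<xi>_le: "\<xi> q \<le> (l + 3 * k) * norm q" for q
    proof -
      have "\<zeta> (q, 0) \<le> (l * norm q + 2 * k * norm (q, 0::'y)) + k * norm (q, 0::'y)"
      proof (rule slope)
        fix u :: "'x \<times> 'y" and t :: real assume t: "t > 0"
        have "norm (fst u - t *\<^sub>R q - xh) \<le> norm (fst u - xh) + t * norm q"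
          using norm_triangle_ineq4[of "fst u - xh" "t *\<^sub>R q"] t by (simp add: algebra_simps)
        then have "l * norm (fst u - t *\<^sub>R q - xh) \<le> l * (norm (fst u - xh) + t * norm q)"
          using l by (intro mult_left_mono)
        then show "T (u - t *\<^sub>R (q, 0)) - T u \<le> t * (l * norm q + 2 * k * norm (q, 0::'y))"
          using T2[OF t, of u "(q, 0)"] by (simp add: T_def algebra_simps)
      qed
      then show ?thesis by (simp add: \<xi> algebra_simps)
    qed
    have n\<xi>: "norm \<xi> \<le> l + 3 * k" using l k by (intro norm_blinfun_le_of_upper \<xi>_le) auto
    \<comment> \<open>Moving \<open>y\<close> towards \<open>h xh\<close> decreases \<open>norm (y - h xh)\<close> at almost unit rate.\<close>
    have "\<zeta> (0, d) \<le> (4 * r - norm d + 2 * k * norm (0::'x, d)) + k * norm (0::'x, d)"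
    proof (rule slope)
      fix u and t :: real
      assume t: "t > 0" and u: "norm (u - zh) < 2 * r" and u': "norm (u - t *\<^sub>R (0, d) - zh) < 2 * r"
      \<comment> \<open>Both points lie within \<open>2 * r\<close> of \<open>zh\<close>, which
        forces \<open>t \<le> 1\<close>. The new difference is a convex combination of
        \<open>q + d\<close> and \<open>q\<close>, so with \<open>norm q \<le> 2 * r\<close> its
        norm drops by at least \<open>t * (norm d - 4 * r)\<close>.\<close>
      have "norm (t *\<^sub>R (0::'x, d)) \<le> norm (u - zh) + norm (u - t *\<^sub>R (0, d) - zh)"
        using norm_triangle_ineq4[of "u - zh" "u - t *\<^sub>R (0, d) - zh"] by simp
      then have "t * norm d \<le> 4 * r" using u u' t by simp
      also have "\<dots> \<le> k * norm d" by (rule r4)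
      finally have "t \<le> 1" using d k by simp
      define q where "q = snd u - yh"
      have q: "norm q \<le> 2 * r"
        using u norm_snd_le[of q "fst u - xh"] by (simp add: q_def zh_eq minus_prod_def)
      have ud: "snd u - h xh = q + d" by (simp add: q_def d_def)
      have "norm (q + d - t *\<^sub>R d) \<le> (1 - t) * norm (q + d) + t * norm q"
      proof -
        have "q + d - t *\<^sub>R d = (1 - t) *\<^sub>R (q + d) + t *\<^sub>R q" by (simp add: algebra_simps)
        also have "norm \<dots> \<le> norm ((1 - t) *\<^sub>R (q + d)) + norm (t *\<^sub>R q)" by (rule norm_triangle_ineq)
        finally show ?thesis using t \<open>t \<le> 1\<close> by simp
      qed
      moreover have "norm d \<le> norm (q + d) + norm q" using norm_triangle_ineq4[of "q + d" q] by simp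
      then have "t * norm d \<le> t * (norm (q + d) + norm q)" using t by (intro mult_left_mono) auto
      moreover have "t * norm q \<le> t * (2 * r)" using t q by (intro mult_left_mono) auto
      ultimately have "norm (q + d - t *\<^sub>R d) - norm (q + d) \<le> t * (4 * r - norm d)"
        by (simp add: algebra_simps)
      moreover have "snd u - t *\<^sub>R d - h xh = q + d - t *\<^sub>R d" using ud by (simp add: algebra_simps)
      ultimately have "norm (snd u - t *\<^sub>R d - h xh) - norm (snd u - h xh) \<le> t * (4 * r - norm d)"
        by (simp only: ud)
      then show "T (u - t *\<^sub>R (0, d)) - T u \<le> t * (4 * r - norm d + 2 * k * norm (0::'x, d))"
        using T2[OF t, of u "(0, d)"] by (simp add: T_def algebra_simps)
    qed
    then have "\<upsilon> d \<le> - ((1 - 4 * k) * norm d)" using r4 by (simp add: \<upsilon> algebra_simps)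
    then have "(1 - 4 * k) * norm d \<le> norm \<upsilon> * norm d" using norm_blinfun[of \<upsilon> d] by simp
    then have n\<upsilon>: "1 - 4 * k \<le> norm \<upsilon>" using d by simp
    define n where "n = norm \<upsilon>"
    have n: "n > 0" unfolding n_def using n\<upsilon> k(2) by linarith
    \<comment> \<open>The covering constant tests unit \<open>ys\<close>, and the precoderivative
      pairs \<open>xs\<close> with \<open>- ys\<close>; hence the division by
      \<open>norm \<upsilon>\<close> and the sign.\<close>
    define xs ys where "xs = (1 / n) *\<^sub>R \<xi>" and "ys = (- 1 / n) *\<^sub>R \<upsilon>"
    have "dual_pair xs (- ys) = (1 / n) *\<^sub>R \<zeta>"
    proof (rule blinfun_eqI)
      fix u
      have "\<zeta> u = \<xi> (fst u) + \<upsilon> (snd u)"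
        by (cases u) (simp add: \<xi> \<upsilon> flip: blinfun.add_right)
      then show "dual_pair xs (- ys) u = ((1 / n) *\<^sub>R \<zeta>) u"
        by (simp add: dual_pair_def xs_def ys_def blinfun.add_left blinfun.scaleR_left blinfun.minus_left
            fst_blinfun.rep_eq snd_blinfun.rep_eq distrib_left)
    qed
    moreover have "(1 / n) *\<^sub>R \<zeta> \<in> prenormal_cone v (gph F)"
      using \<zeta> n by (intro prenormal_cone_scaleR) auto
    ultimately have "xs \<in> precoderivative F (fst v) (snd v) ys" by (simp add: precoderivative_def)
    moreover have "snd v \<in> F (fst v)" using v(1) by (auto simp: gph_def)
    moreover have "norm ((fst v, snd v) - (xb, yb)) \<le> R" using in_R[OF v(2)] by (simp add: zb_def)
    moreover have "norm ys = 1" using n by (simp add: ys_def n_def)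
    ultimately have "\<alpha> \<le> norm xs" by (rule cov)
    also have "norm xs = norm \<xi> / n" using n by (simp add: xs_def)
    finally have "\<alpha> * n \<le> norm \<xi>" using n by (simp add: field_simps)
    moreover have "0 < \<alpha> * (1 - 4 * k)" using k l by linarith
    then have "\<alpha> > 0" using k by (simp add: zero_less_mult_iff)
    then have "\<alpha> * (1 - 4 * k) \<le> \<alpha> * n" using n\<upsilon> by (simp add: n_def)
    ultimately show False using n\<xi> k(3) by linarith
  qed
  moreover have "yh \<in> F xh" using zh(1) by (simp add: S_def gph_def zh_eq)
  moreover have "norm (xh - xb) \<le> norm (yb - h xb) / k" using fst_le[of zh] zhd by (simp add: xh_def)
  ultimately show ?thesis using that by auto
qed

section \<open>Feasible points for perturbed parameters\<close>

text \<open>A real \<open>\<alpha>\<close> strictly above \<open>l\<close> and below the infimum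
  exists also when the infimum is infinite. The gap \<open>\<alpha> - l\<close> later pays for the
  losses of size \<open>k\<close>.\<close>

lemma ereal_less_covering_constD:
  assumes "ereal l < covering_const F xb yb"
  obtains \<eta> \<alpha> where "\<eta> > 0" "l < \<alpha>"
    "\<And>x y xs ys. xs \<in> precoderivative F x y ys \<Longrightarrow> x \<in> cball xb \<eta> \<Longrightarrow> y \<in> F x \<Longrightarrow> y \<in> cball yb \<eta> \<Longrightarrow>
       norm ys = 1 \<Longrightarrow> \<alpha> \<le> norm xs"
proof -
  obtain \<eta> where \<eta>: "\<eta> > 0" and less: "ereal l < Inf {ereal (norm xs) | xs x y ys.
      xs \<in> precoderivative F x y ys \<and> x \<in> cball xb \<eta> \<and> y \<in> F x \<inter> cball yb \<eta> \<and> norm ys = 1}"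
    using assms unfolding covering_const_def less_SUP_iff by auto
  obtain \<alpha> where \<alpha>: "ereal l < ereal \<alpha>" "ereal \<alpha> < Inf {ereal (norm xs) | xs x y ys.
      xs \<in> precoderivative F x y ys \<and> x \<in> cball xb \<eta> \<and> y \<in> F x \<inter> cball yb \<eta> \<and> norm ys = 1}"
    using ereal_dense2[OF less] by blast
  show ?thesis
  proof (rule that[OF \<eta>])
    fix x y xs ys
    assume "xs \<in> precoderivative F x y ys" "x \<in> cball xb \<eta>" "y \<in> F x" "y \<in> cball yb \<eta>" "norm ys = 1"
    then have "Inf {ereal (norm xs) | xs x y ys.
      xs \<in> precoderivative F x y ys \<and> x \<in> cball xb \<eta> \<and> y \<in> F x \<inter> cball yb \<eta> \<and> norm ys = 1} \<le> ereal (norm xs)"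
      by (intro Inf_lower) blast
    then have "ereal \<alpha> < ereal (norm xs)" using \<alpha>(2) by (rule less_le_trans[rotated])
    then show "\<alpha> \<le> norm xs" by simp
  qed (use \<alpha> in simp)
qed

text \<open>The equation for \<open>g (_, p)\<close> is solved starting from
  \<open>(xb, g (xb, pb))\<close> in the graph, where the residual is the change of
  \<open>g (xb, _)\<close>. Radius, Lipschitz modulus and covering bound are the same for all
  \<open>p\<close>, hence so are \<open>k\<close> and \<open>\<delta>\<close>.\<close>

lemma feasible_near_solution:
  fixes F :: "'x::banach \<Rightarrow> 'y::banach set" and g :: "'x \<times> 'p \<Rightarrow> 'y"
  assumes asp: "asplund TYPE('x)" "asplund TYPE('y)"
    and cl: "closed_around F xb (g (xb, pb))"
    and U: "xb \<in> interior U" and l: "l \<ge> 0"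
    and lip: "\<And>p. p \<in> V \<Longrightarrow> lipschitz_on l U (\<lambda>x. g (x, p))"
    and cov: "ereal l < covering_const F xb (g (xb, pb))"
  obtains k \<delta> where "k > 0" "\<delta> > 0"
    "\<And>p. p \<in> V \<Longrightarrow> norm (g (xb, p) - g (xb, pb)) < \<delta> \<Longrightarrow>
       \<exists>x\<in>feasible F g p. norm (x - xb) \<le> norm (g (xb, p) - g (xb, pb)) / k"
proof -
  define yb where "yb = g (xb, pb)"
  obtain \<eta> \<alpha> where \<eta>: "\<eta> > 0" and \<alpha>: "l < \<alpha>"
    and cov': "\<And>x y xs ys. xs \<in> precoderivative F x y ys \<Longrightarrow> x \<in> cball xb \<eta> \<Longrightarrow> y \<in> F x \<Longrightarrow>
       y \<in> cball yb \<eta> \<Longrightarrow> norm ys = 1 \<Longrightarrow> \<alpha> \<le> norm xs"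
    using ereal_less_covering_constD[OF cov] unfolding yb_def by blast
  obtain A B where gr: "(xb, yb) \<in> gph F" and A: "xb \<in> interior A" and B: "yb \<in> interior B"
    and clAB: "closed (gph F \<inter> (closure A \<times> closure B))"
    using cl unfolding closed_around_def yb_def by blast
  obtain r1 r2 r3 where r: "r1 > 0" "cball xb r1 \<subseteq> A" "r2 > 0" "cball yb r2 \<subseteq> B" "r3 > 0" "cball xb r3 \<subseteq> U"
    using A B U unfolding mem_interior_cball by blast
  define R where "R = min (min r1 r2) (min r3 \<eta>)"
  have R: "R > 0" "R \<le> r1" "R \<le> r2" "R \<le> r3" "R \<le> \<eta>" using r \<eta> by (auto simp: R_def)
  have fstR: "norm (x - xb) \<le> R" and sndR: "norm (y - yb) \<le> R" if "norm ((x, y) - (xb, yb)) \<le> R" for x y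
    using norm_fst_le[of "x - xb" "y - yb"] norm_snd_le[of "y - yb" "x - xb"] that by auto
  have "cball (xb, yb) R \<subseteq> closure A \<times> closure B"
  proof
    fix u assume u: "u \<in> cball (xb, yb) R"
    obtain x y where xy: "u = (x, y)" by fastforce
    have "norm ((x, y) - (xb, yb)) \<le> R"
      using u unfolding xy mem_cball dist_norm by (subst norm_minus_commute)
    from fstR[OF this] sndR[OF this] have "x \<in> cball xb r1" "y \<in> cball yb r2"
      using R by (auto simp: dist_norm norm_minus_commute)
    then have "x \<in> A" "y \<in> B" using r by blast+
    then show "u \<in> closure A \<times> closure B" using closure_subset[of A] closure_subset[of B] by (auto simp: xy)
  qed
  then have "gph F \<inter> cball (xb, yb) R = (gph F \<inter> (closure A \<times> closure B)) \<inter> cball (xb, yb) R" by blast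
  then have clR: "closed (gph F \<inter> cball (xb, yb) R)" using clAB by (metis closed_Int closed_cball)
  \<comment> \<open>\<open>l + 3 * k < \<alpha> * (1 - 4 * k)\<close> amounts to
    \<open>k * (3 + 4 * \<alpha>) < \<alpha> - l\<close>; the second term uses at most half of this
    gap, and \<open>1/8\<close> secures \<open>4 * k < 1\<close>.\<close>
  define k where "k = min (1/8) ((\<alpha> - l) / (2 * (3 + 4 * \<alpha>)))"
  have den: "3 + 4 * \<alpha> > 0" using l \<alpha> by simp
  have k: "k > 0" "4 * k < 1" using \<alpha> den by (auto simp: k_def)
  have "k \<le> (\<alpha> - l) / (2 * (3 + 4 * \<alpha>))" by (simp add: k_def)
  then have "k * (2 * (3 + 4 * \<alpha>)) \<le> \<alpha> - l" using den by (simp only: pos_le_divide_eq mult_pos_pos zero_less_numeral)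
  moreover have "k * (3 + 4 * \<alpha>) > 0" using k den by simp
  ultimately have kl: "l + 3 * k < \<alpha> * (1 - 4 * k)" by (simp add: algebra_simps)
  have ybF: "yb \<in> F xb" using gr by (simp add: gph_def)
  show ?thesis
  proof (rule that[of k "k * R"])
    fix p assume p: "p \<in> V" and small: "norm (g (xb, p) - g (xb, pb)) < k * R"
    have lipp: "norm (g (x, p) - g (x', p)) \<le> l * norm (x - x')" if "norm (x - xb) \<le> R" "norm (x' - xb) \<le> R" for x x'
    proof -
      have "x \<in> U" "x' \<in> U" using that R r by (auto simp: subset_iff dist_norm norm_minus_commute)
      then show ?thesis using lipschitz_onD[OF lip[OF p]] by (simp add: dist_norm)
    qed
    obtain x where "g (x, p) \<in> F x" "norm (x - xb) \<le> norm (yb - g (xb, p)) / k"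
    proof (rule generalized_equation_solvable[OF asp clR ybF, of "\<lambda>x. g (x, p)" l k \<alpha>])
      fix x y xs ys
      assume *: "xs \<in> precoderivative F x y ys" "y \<in> F x" "norm ((x, y) - (xb, yb)) \<le> R" "norm ys = 1"
      show "\<alpha> \<le> norm xs"
        using fstR[OF *(3)] sndR[OF *(3)] R
        by (intro cov'[OF *(1) _ *(2) _ *(4)]) (auto simp: dist_norm norm_minus_commute)
    qed (use l k kl lipp small in \<open>auto simp: yb_def norm_minus_commute\<close>)
    then show "\<exists>x\<in>feasible F g p. norm (x - xb) \<le> norm (g (xb, p) - g (xb, pb)) / k"
      by (intro bexI[of _ x]) (auto simp: feasible_def yb_def norm_minus_commute intro!: exI[of _ "g (x, p)"])
  qed (use k R in auto)
qed

section \<open>Upper semicontinuity and one-sided calmness of the value function\<close>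

theorem theorem5p1:
  fixes F :: "'x::banach \<Rightarrow> 'y::banach set"
    and g :: "'x \<times> 'p::topological_space \<Rightarrow> 'y"
    and \<phi> :: "'x \<times> 'p \<Rightarrow> ereal"
    and xb :: 'x and pb :: 'p
    and U :: "'x set" and V :: "'p set" and l :: real
  assumes "asplund TYPE('x)" and "asplund TYPE('y)"
    and "\<And>z. \<phi> z \<noteq> -\<infinity>"
    and "is_solution F g \<phi> pb xb"
    and "usc_at \<phi> (xb, pb)"
    and "closed_around F xb (g (xb, pb))"
    and "xb \<in> interior U" and "pb \<in> interior V" and "l \<ge> 0"
    and "\<And>p. p \<in> V \<Longrightarrow> lipschitz_on l U (\<lambda>x. g (x, p))"
    and "continuous_on V (\<lambda>p. g (xb, p))"
    and "ereal l < covering_const F xb (g (xb, pb))"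
  shows "usc_at (opt_value F g \<phi>) pb \<and>
    (\<forall>\<rho> :: 'p \<Rightarrow> 'p \<Rightarrow> real.
       Metric_space UNIV \<rho> \<and> Metric_space.mtopology UNIV \<rho> = euclidean \<and>
       (\<exists>\<kappa>\<^sub>1. ereal_calm_at (sum_dist \<rho>) \<phi> (xb, pb) \<kappa>\<^sub>1) \<and>
       (\<exists>\<kappa>\<^sub>2. calm_at \<rho> (\<lambda>p. g (xb, p)) pb \<kappa>\<^sub>2) \<longrightarrow>
       (\<exists>\<kappa>>0. \<exists>W. pb \<in> interior W \<and>
          (\<forall>p\<in>W. opt_value F g \<phi> p \<le> opt_value F g \<phi> pb + ereal (\<kappa> * \<rho> p pb))))"
proof -
  obtain k \<delta> where k: "k > 0" and \<delta>: "\<delta> > 0"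
    and near: "\<And>p. p \<in> V \<Longrightarrow> norm (g (xb, p) - g (xb, pb)) < \<delta> \<Longrightarrow>
       \<exists>x\<in>feasible F g p. norm (x - xb) \<le> norm (g (xb, p) - g (xb, pb)) / k"
    using feasible_near_solution[OF assms(1,2,6,7,9,10,12)] by blast
  have \<mu>_le: "opt_value F g \<phi> p \<le> \<phi> (x, p)" if "x \<in> feasible F g p" for x p
    unfolding opt_value_def using that by (rule INF_lower)
  have \<mu>pb: "opt_value F g \<phi> pb = \<phi> (xb, pb)"
    using assms(4) unfolding is_solution_def opt_value_def by (auto intro!: antisym INF_lower INF_greatest)
  have cont: "((\<lambda>p. g (xb, p)) \<longlongrightarrow> g (xb, pb)) (at pb)"
  proof -
    have "pb \<in> V" using assms(8) interior_subset by blast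
    then have "((\<lambda>p. g (xb, p)) \<longlongrightarrow> g (xb, pb)) (at pb within V)"
      using assms(11) unfolding continuous_on_def by blast
    then show ?thesis by (simp only: at_within_interior[OF assms(8)])
  qed
  have evV: "\<forall>\<^sub>F p in at pb. p \<in> V"
  proof -
    have "\<forall>\<^sub>F p in at pb. p \<in> interior V" using assms(8) by (intro eventually_at_in_open') auto
    then show ?thesis by eventually_elim (use interior_subset in blast)
  qed
  have "usc_at (opt_value F g \<phi>) pb"
    unfolding usc_at_def Limsup_le_iff \<mu>pb
  proof (intro allI impI)
    fix b assume b: "\<phi> (xb, pb) < b"
    have "\<forall>\<^sub>F z in at (xb, pb). \<phi> z < b"
      using assms(5) b unfolding usc_at_def by (intro Limsup_lessD) auto
    \<comment> \<open>\<open>at\<close> leaves out the point itself, where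
      \<open>\<phi> (xb, pb) < b\<close> is given. The bound thus holds on a full neighborhood,
      which contains a product of open sets.\<close>
    then have "\<forall>\<^sub>F z in nhds (xb, pb). \<phi> z < b"
      using b by (auto simp: eventually_at_filter elim: eventually_mono)
    then obtain \<Omega> where \<Omega>: "open \<Omega>" "(xb, pb) \<in> \<Omega>" "\<And>z. z \<in> \<Omega> \<Longrightarrow> \<phi> z < b"
      unfolding eventually_nhds by blast
    obtain A B where AB: "open A" "open B" "(xb, pb) \<in> A \<times> B" "A \<times> B \<subseteq> \<Omega>"
      using \<Omega>(1,2) by (rule open_prod_elim)
    obtain r where r: "r > 0" "ball xb r \<subseteq> A" using AB by (auto simp: open_contains_ball)
    have "\<forall>\<^sub>F p in at pb. p \<in> B" using AB by (intro eventually_at_in_open') auto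
    \<comment> \<open>\<open>\<delta>\<close> provides a feasible point, and \<open>k * r\<close>
      places it in \<open>ball xb r\<close>.\<close>
    moreover have "\<forall>\<^sub>F p in at pb. dist (g (xb, p)) (g (xb, pb)) < min \<delta> (k * r)"
      using k \<delta> r by (intro tendstoD[OF cont]) auto
    ultimately show "\<forall>\<^sub>F p in at pb. opt_value F g \<phi> p < b"
      using evV
    proof eventually_elim
      case (elim p)
      then have small: "norm (g (xb, p) - g (xb, pb)) < \<delta>" "norm (g (xb, p) - g (xb, pb)) / k < r"
        using k by (auto simp: dist_norm divide_less_eq mult.commute)
      obtain x where x: "x \<in> feasible F g p" "norm (x - xb) \<le> norm (g (xb, p) - g (xb, pb)) / k"
        using near[OF elim(3) small(1)] by blast
      have "x \<in> ball xb r" using x(2) small(2) by (simp add: dist_norm norm_minus_commute)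
      then have "(x, p) \<in> \<Omega>" using r AB elim(1) by blast
      then show ?case using \<Omega>(3) \<mu>_le[OF x(1)] le_less_trans by blast
    qed
  qed
  moreover have "\<exists>\<kappa>>0. \<exists>W. pb \<in> interior W \<and>
        (\<forall>p\<in>W. opt_value F g \<phi> p \<le> opt_value F g \<phi> pb + ereal (\<kappa> * \<rho> p pb))"
    if met: "Metric_space UNIV \<rho>" and top: "Metric_space.mtopology UNIV \<rho> = euclidean"
      and c1: "ereal_calm_at (sum_dist \<rho>) \<phi> (xb, pb) \<kappa>1" and c2: "calm_at \<rho> (\<lambda>p. g (xb, p)) pb \<kappa>2"
    for \<rho> :: "'p \<Rightarrow> 'p \<Rightarrow> real" and \<kappa>1 \<kappa>2
  proof -
    interpret M: Metric_space UNIV \<rho> by (rule met)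
    obtain \<delta>1 where \<delta>1: "\<delta>1 > 0" "\<And>z. sum_dist \<rho> z (xb, pb) < \<delta>1 \<Longrightarrow> \<bar>\<phi> z\<bar> \<noteq> \<infinity>"
      using c1 unfolding ereal_calm_at_def by blast
    obtain \<delta>2 where \<kappa>1: "\<kappa>1 \<ge> 0" and \<delta>2: "\<delta>2 > 0" "\<And>z. sum_dist \<rho> z (xb, pb) < \<delta>2 \<Longrightarrow>
        norm (real_of_ereal (\<phi> z) - real_of_ereal (\<phi> (xb, pb))) \<le> \<kappa>1 * sum_dist \<rho> z (xb, pb)"
      using c1 unfolding ereal_calm_at_def calm_at_def by blast
    obtain \<delta>3 where \<kappa>2: "\<kappa>2 \<ge> 0" and \<delta>3: "\<delta>3 > 0" "\<And>p. \<rho> p pb < \<delta>3 \<Longrightarrow>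
        norm (g (xb, p) - g (xb, pb)) \<le> \<kappa>2 * \<rho> p pb"
      using c2 unfolding calm_at_def by blast
    have "openin M.mtopology (interior V)" by (simp add: top)
    then obtain \<delta>4 where \<delta>4: "\<delta>4 > 0" "M.mball pb \<delta>4 \<subseteq> interior V"
      unfolding M.openin_mtopology using assms(8) by blast
    \<comment> \<open>The feasible point is within \<open>\<kappa>2 * t / k\<close> of
      \<open>xb\<close> for \<open>t = \<rho> p pb\<close>; the summand 1 accounts for the parameter
      in \<open>sum_dist\<close>.\<close>
    define L where "L = \<kappa>2 / k + 1"
    have L: "L > 0" using \<kappa>2 k by (simp add: L_def add_nonneg_pos)
    \<comment> \<open>In this order: calmness of \<open>g (xb, _)\<close>, membership in
      \<open>V\<close>, residual below \<open>\<delta>\<close> (with \<open>\<kappa>2 + 1\<close> as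
      a positive denominator), and calmness and finiteness of \<open>\<phi>\<close>.\<close>
    define \<gamma> where "\<gamma> = min (min \<delta>3 \<delta>4) (min (\<delta> / (\<kappa>2 + 1)) (min \<delta>1 \<delta>2 / L))"
    have \<gamma>: "\<gamma> > 0" using \<delta>1 \<delta>2 \<delta>3 \<delta>4 \<delta> \<kappa>2 L by (simp add: \<gamma>_def)
    define W where "W = M.mball pb \<gamma>"
    have "open W" using M.openin_mball[of pb \<gamma>] by (simp add: top W_def)
    moreover have "pb \<in> W" using \<gamma> by (simp add: W_def)
    ultimately have "pb \<in> interior W" by (simp add: interior_open)
    moreover have "opt_value F g \<phi> p \<le> opt_value F g \<phi> pb + ereal ((\<kappa>1 * L + 1) * \<rho> p pb)" if "p \<in> W" for p
    proof -
      define t where "t = \<rho> p pb"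
      have t0: "t \<ge> 0" by (simp add: t_def)
      have t: "t < \<gamma>" using that by (simp add: W_def t_def M.commute)
      have tL: "L * t < min \<delta>1 \<delta>2"
      proof -
        have "t < min \<delta>1 \<delta>2 / L" using t by (simp add: \<gamma>_def)
        then show ?thesis using L by (simp only: pos_less_divide_eq mult.commute)
      qed
      have pV: "p \<in> V"
      proof -
        have "p \<in> M.mball pb \<delta>4" using that by (simp add: W_def \<gamma>_def)
        then show ?thesis using \<delta>4(2) interior_subset[of V] by blast
      qed
      have g_le: "norm (g (xb, p) - g (xb, pb)) \<le> \<kappa>2 * t"
        using \<delta>3(2)[of p] t by (simp add: t_def \<gamma>_def)
      also have "\<dots> \<le> (\<kappa>2 + 1) * t" using t0 by (simp add: distrib_right)
      also have "\<dots> < \<delta>" using t \<kappa>2 by (simp add: \<gamma>_def pos_less_divide_eq mult.commute)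
      finally obtain x where x: "x \<in> feasible F g p" "norm (x - xb) \<le> norm (g (xb, p) - g (xb, pb)) / k"
        using near[OF pV] by blast
      have "norm (x - xb) \<le> \<kappa>2 * t / k"
        using x(2) g_le k by (meson divide_right_mono less_imp_le order_trans)
      then have sd: "sum_dist \<rho> (x, p) (xb, pb) \<le> L * t" by (simp add: sum_dist_def t_def L_def algebra_simps)
      \<comment> \<open>Calmness of \<open>\<phi>\<close> is stated through
        \<open>real_of_ereal\<close>, which sends infinite values to 0; finiteness at both points
        carries the estimate back to \<open>\<phi>\<close>.\<close>
      have fin: "\<bar>\<phi> (x, p)\<bar> \<noteq> \<infinity>" "\<bar>\<phi> (xb, pb)\<bar> \<noteq> \<infinity>"
        using \<delta>1 sd tL by (auto simp: sum_dist_def)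
      have "norm (real_of_ereal (\<phi> (x, p)) - real_of_ereal (\<phi> (xb, pb))) \<le> \<kappa>1 * sum_dist \<rho> (x, p) (xb, pb)"
        using sd tL by (intro \<delta>2(2)) simp
      also have "\<dots> \<le> \<kappa>1 * (L * t)" using sd \<kappa>1 by (intro mult_left_mono)
      also have "\<dots> \<le> (\<kappa>1 * L + 1) * t" using t0 by (simp add: algebra_simps)
      finally have "real_of_ereal (\<phi> (x, p)) \<le> real_of_ereal (\<phi> (xb, pb)) + (\<kappa>1 * L + 1) * t" by simp
      then have "ereal (real_of_ereal (\<phi> (x, p))) \<le> ereal (real_of_ereal (\<phi> (xb, pb))) + ereal ((\<kappa>1 * L + 1) * t)"
        by simp
      then have "\<phi> (x, p) \<le> \<phi> (xb, pb) + ereal ((\<kappa>1 * L + 1) * t)"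
        using fin by (simp add: ereal_real')
      then show ?thesis using \<mu>_le[OF x(1)] by (simp add: \<mu>pb t_def)
    qed
    moreover have "\<kappa>1 * L + 1 > 0" using \<kappa>1 L by (simp add: add_nonneg_pos)
    ultimately show ?thesis by blast
  qed
  ultimately show ?thesis by blast
qed

end
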